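(* Let $p$ be a prime and $G=\mathbb{Z}\times\mathbb{Z}_p=\langle z\rangle\times\langle a\rangle$. Let $\mathcal{S}$ be a Schur ring over $G$ such that $\mathbb{Z}^{(p)}=\langle z^p\rangle$ is an $\mathcal{S}$-subgroup. Suppose that $z\mathbb{Z}_p$ or $\{z,z^{-1}\}\mathbb{Z}_p=z\mathbb{Z}_p\cup z^{-1}\mathbb{Z}_p$ is the union of exactly two $\mathcal{S}$-classes. Then $\mathcal{S}$ is an automorphic Schur ring.
   Context: $F$ is a field of characteristic $0$; $\mathbb{Z}=\langle z\rangle$ infinite cyclic, $\mathbb{Z}_p=\langle a\rangle$ cyclic of order $p$, written multiplicatively. For finite $C\subseteq G$, $\overline{C}=\sum_{g\in C}g$ and $C^*=\{g^{-1}:g\in C\}$. A Schur ring over $G$ is a subspace $\mathcal{S}=\mathrm{Span}_F\{\overline{C}:C\in\mathcal{D}\}$ of $F[G]$, where $\mathcal{D}$ is a partition of $G$ into finite subsets with $\{1\}\in\mathcal{D}$, $C\in\mathcal{D}\Rightarrow C^*\in\mathcal{D}$, and each $\overline{C}\,\overline{D}$ a finite $F$-linear combination of the $\overline{E}$, $E\in\mathcal{D}$; members of $\mathcal{D}$ are $\mathcal{S}$-classes, an $\mathcal{S}$-subgroup is a subgroup that is a union of classes. $\mathcal{S}$ is automorphic if $\mathcal{S}=F[G]^{\mathcal{H}}$ (elements fixed by $\mathcal{H}$; classes the $\mathcal{H}$-orbits) for some finite $\mathcal{H}\le\operatorname{Aut}(G)$. *)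

theory Defs
  imports "HOL-Computational_Algebra.Primes"
begin

text \<open>The group G = Z x Z_p, realised concretely on pairs (m,k) :: int * int with
  0 <= k < p; (m,k) stands for z^m a^k.  The group law is written multiplicatively
  in the paper; here it is componentwise addition (second component mod p).\<close>

definition Gc :: "nat \<Rightarrow> (int \<times> int) set" where
  "Gc p = {(m, k). 0 \<le> k \<and> k < int p}"

definition gmul :: "nat \<Rightarrow> int \<times> int \<Rightarrow> int \<times> int \<Rightarrow> int \<times> int" where
  "gmul p g h = (fst g + fst h, (snd g + snd h) mod int p)"

definition ginv :: "nat \<Rightarrow> int \<times> int \<Rightarrow> int \<times> int" where
  "ginv p g = (- fst g, (- snd g) mod int p)"

definition gone :: "int \<times> int" where
  "gone = (0, 0)"

definition group_alg :: "nat \<Rightarrow> ((int \<times> int) \<Rightarrow> 'f::field) set" where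
  "group_alg p = {f. finite {g. f g \<noteq> 0} \<and> {g. f g \<noteq> 0} \<subseteq> Gc p}"

definition cls_sum :: "(int \<times> int) set \<Rightarrow> (int \<times> int) \<Rightarrow> 'f::field" where
  "cls_sum C = (\<lambda>g. if g \<in> C then 1 else 0)"

definition cls_prod :: "nat \<Rightarrow> (int \<times> int) set \<Rightarrow> (int \<times> int) set \<Rightarrow> (int \<times> int) \<Rightarrow> 'f::field" where
  "cls_prod p C D = (\<lambda>x. of_nat (card {(c, d). c \<in> C \<and> d \<in> D \<and> gmul p c d = x}))"

definition span_cls :: "(int \<times> int) set set \<Rightarrow> ((int \<times> int) \<Rightarrow> 'f::field) set" where
  "span_cls \<D> = {(\<lambda>x. \<Sum>C\<in>T. c C * cls_sum C x) | T c. finite T \<and> T \<subseteq> \<D>}"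

definition schur_ring :: "nat \<Rightarrow> (int \<times> int) set set \<Rightarrow> ((int \<times> int) \<Rightarrow> 'f::field) set \<Rightarrow> bool" where
  "schur_ring p \<D> S \<longleftrightarrow>
     (\<forall>C\<in>\<D>. C \<noteq> {} \<and> finite C \<and> C \<subseteq> Gc p) \<and>
     (\<forall>C\<in>\<D>. \<forall>D\<in>\<D>. C \<noteq> D \<longrightarrow> C \<inter> D = {}) \<and>
     \<Union>\<D> = Gc p \<and>
     {gone} \<in> \<D> \<and>
     (\<forall>C\<in>\<D>. ginv p ` C \<in> \<D>) \<and>
     (\<forall>C\<in>\<D>. \<forall>D\<in>\<D>. cls_prod p C D \<in> S) \<and>
     S = span_cls \<D>"

definition S_subgroup :: "(int \<times> int) set set \<Rightarrow> (int \<times> int) set \<Rightarrow> bool" where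
  "S_subgroup \<D> K \<longleftrightarrow> (\<forall>C\<in>\<D>. C \<subseteq> K \<or> C \<inter> K = {})"

definition aut :: "nat \<Rightarrow> ((int \<times> int) \<Rightarrow> (int \<times> int)) set" where
  "aut p = {\<sigma>. bij_betw \<sigma> (Gc p) (Gc p) \<and>
                (\<forall>g\<in>Gc p. \<forall>h\<in>Gc p. \<sigma> (gmul p g h) = gmul p (\<sigma> g) (\<sigma> h)) \<and>
                (\<forall>x. x \<notin> Gc p \<longrightarrow> \<sigma> x = x)}"

definition aut_subgroup :: "nat \<Rightarrow> ((int \<times> int) \<Rightarrow> (int \<times> int)) set \<Rightarrow> bool" where
  "aut_subgroup p H \<longleftrightarrow> H \<subseteq> aut p \<and> id \<in> H \<and> (\<forall>\<sigma>\<in>H. \<forall>\<tau>\<in>H. \<sigma> \<circ> \<tau> \<in> H) \<and>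
                         (\<forall>\<sigma>\<in>H. \<exists>\<tau>\<in>H. \<tau> \<circ> \<sigma> = id)"

text \<open>Fixed subalgebra F[G]^H: sum a_g g is fixed by \<sigma> iff a_(\<sigma> g) = a_g for all g.\<close>
definition fixed_alg :: "nat \<Rightarrow> ((int \<times> int) \<Rightarrow> (int \<times> int)) set \<Rightarrow> ((int \<times> int) \<Rightarrow> 'f::field) set" where
  "fixed_alg p H = {f \<in> group_alg p. \<forall>\<sigma>\<in>H. \<forall>g\<in>Gc p. f (\<sigma> g) = f g}"

definition automorphic :: "nat \<Rightarrow> ((int \<times> int) \<Rightarrow> 'f::field) set \<Rightarrow> bool" where
  "automorphic p S \<longleftrightarrow> (\<exists>H. finite H \<and> aut_subgroup p H \<and> S = fixed_alg p H)"

end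

theory Submission
  imports Defs "HOL-Library.Poly_Mapping" "HOL-Number_Theory.Number_Theory"
begin

text \<open>Write A for Z_p and let zB be the part of a class in the layer zA. If B is neither empty nor A, then B is not
  a zero divisor modulo the sum of all elements of A. Multiplication by a class of A maps zB to a combination of zB and
  zA, so every class of A acts on B as an integer, and the only classes in A are {1} and its complement. In
  particular B is a difference set. Its order n is 1: for every prime l other than p, the power B^N with N = l^(p-1)
  returns to the layer of z after a shift by a power of z^p, so B^N = aB modulo A, while B^N = B modulo l.
  Hence B or its complement is a single element w, and S is determined by w. If the layers of z and its inverse are
  linked by the classes, the same argument runs on the sums z^j U + z^-j V.
  When zA itself is a class, all the layers z^j A with j prime to p are classes and Schur's theorem on
  multipliers describes the classes in A.
  In all cases the classes are the orbits of an explicit group of maps (m, k) \<mapsto> (em, sm + tk).\<close>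

text \<open>Characteristic 0 lets the integers replace the field: structure constants are counts,
  and modulo a prime l the power B^l is the image of B under g -> g^l. The primes play two roles.
  Modulo p the power B^p is the integer card B, prime to p, and this is why B can be cancelled; the
  other primes l bound n. The subgroup of z^p supplies known elements: it meets a layer in at most
  one point, which gives z^(pm), or z^(pm) + z^(-pm) if opposite layers are linked, and these carry
  the layer of z^N back to that of z whenever N = 1 modulo p. The delicate case is the union of the
  layers of z and its inverse. A product of two elements then has four layers, told apart only by
  the absolute value of the exponent. Moreover inversion may exchange the two classes; counting
  modulo p at z^p and z^-p then forces the layers apart unless p = 2. For p = 2 there is a true
  exception, a class {w, w'} in which w' is not the inverse of w.\<close>

section \<open>Powers of sums modulo a prime\<close>

text \<open>The inner binomial coefficients are multiples of l. Divisibility in an arbitrary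
  commutative ring serves both the group ring of Z_p and that of Z x Z_p.\<close>

lemma of_nat_prime_dvd_freshman:
  fixes a b :: "'a::comm_ring_1"
  assumes "prime l"
  shows "of_nat l dvd (a + b) ^ l - a ^ l - b ^ l"
proof -
  have l: "0 < l" using assms by (simp add: prime_gt_0_nat)
  have "(a + b) ^ l = (\<Sum>k\<le>l. of_nat (l choose k) * a ^ k * b ^ (l - k))"
    by (rule binomial_ring)
  also have "{..l} = insert 0 (insert l {0<..<l})" using l by auto
  also have "(\<Sum>k\<in>insert 0 (insert l {0<..<l}). of_nat (l choose k) * a ^ k * b ^ (l - k))
      = b ^ l + (a ^ l + (\<Sum>k\<in>{0<..<l}. of_nat (l choose k) * a ^ k * b ^ (l - k)))"
    using l by simp
  finally have eq: "(a + b) ^ l - a ^ l - b ^ l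
      = (\<Sum>k\<in>{0<..<l}. of_nat (l choose k) * a ^ k * b ^ (l - k))" by simp
  have "of_nat l dvd (of_nat (l choose k) :: 'a)" if "k \<in> {0<..<l}" for k
  proof -
    have "l dvd l choose k" using that assms by (intro dvd_choose_prime) auto
    then show ?thesis by (auto elim!: dvdE)
  qed
  then show ?thesis unfolding eq by (intro dvd_sum) (simp add: mult.assoc)
qed

lemma dvd_diff_power:
  fixes x y d :: "'a::comm_ring_1"
  assumes "d dvd x - y" shows "d dvd x ^ n - y ^ n"
  using assms by (simp add: power_diff_sumr2)

lemma of_nat_prime_dvd_freshman_sum:
  fixes f :: "'b \<Rightarrow> 'a::comm_ring_1"
  assumes l: "prime l" and "finite X"
  shows "of_nat l dvd (\<Sum>x\<in>X. f x) ^ l - (\<Sum>x\<in>X. f x ^ l)"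
  using assms(2)
proof induction
  case empty
  then show ?case using prime_gt_0_nat[OF l] by (simp add: power_0_left)
next
  case (insert x X)
  have "of_nat l dvd ((f x + sum f X) ^ l - f x ^ l - sum f X ^ l)
      + (sum f X ^ l - (\<Sum>x\<in>X. f x ^ l))"
    by (intro dvd_add of_nat_prime_dvd_freshman l insert)
  then show ?case using insert by (simp add: algebra_simps)
qed

lemma of_nat_prime_dvd_freshman_sum_power:
  fixes f :: "'b \<Rightarrow> 'a::comm_ring_1"
  assumes l: "prime l" and X: "finite X"
  shows "of_nat l dvd (\<Sum>x\<in>X. f x) ^ (l ^ e) - (\<Sum>x\<in>X. f x ^ (l ^ e))"
proof (induction e)
  case 0
  then show ?case by simp
next
  case (Suc e)
  have "of_nat l dvd ((\<Sum>x\<in>X. f x) ^ (l ^ e)) ^ l - (\<Sum>x\<in>X. f x ^ (l ^ e)) ^ l"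
    by (rule dvd_diff_power[OF Suc])
  from dvd_add[OF this of_nat_prime_dvd_freshman_sum[OF l X, of "\<lambda>x. f x ^ (l ^ e)"]]
  have "of_nat l dvd ((\<Sum>x\<in>X. f x) ^ (l ^ e)) ^ l - (\<Sum>x\<in>X. (f x ^ (l ^ e)) ^ l)"
    by simp
  moreover have "(a ^ (l ^ e)) ^ l = a ^ (l ^ Suc e)" for a :: 'a
    by (simp add: power_mult[symmetric] power_Suc2 del: power_Suc)
  ultimately show ?case by simp
qed

text \<open>An additive statement need only be checked on monomials; the monomial with coefficient 0
  is the base case.\<close>

lemma poly_mapping_single_add_induct [case_names single add]:
  fixes f :: "'a \<Rightarrow>\<^sub>0 'b::comm_monoid_add"
  assumes "\<And>k c. P (Poly_Mapping.single k c)" "\<And>f g. P f \<Longrightarrow> P g \<Longrightarrow> P (f + g)"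
  shows "P f"
proof (induction f rule: update_induct)
  case const
  then show ?case using assms(1)[of _ 0] by simp
next
  case (update f a b)
  have "Poly_Mapping.update a b f = f + Poly_Mapping.single a b"
    using update by (intro poly_mapping_eqI)
      (auto simp: lookup_update lookup_add lookup_single in_keys_iff)
  then show ?case using update assms by simp
qed

lemma single_power:
  fixes c :: "'b::comm_semiring_1"
  shows "Poly_Mapping.single (k::int) c ^ n = Poly_Mapping.single (int n * k) (c ^ n)"
proof (induction n)
  case 0
  then show ?case by simp
next
  case (Suc n)
  then show ?case by (simp add: mult_single distrib_right)
qed

lemma lookup_single_mult:
  fixes f :: "int \<Rightarrow>\<^sub>0 'b::comm_ring_1"
  shows "Poly_Mapping.lookup (Poly_Mapping.single i c * f) m = c * Poly_Mapping.lookup f (m - i)"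
proof (induction f rule: poly_mapping_single_add_induct)
  case (single k d)
  have "i + k = m \<longleftrightarrow> k = m - i" by auto
  then show ?case by (simp add: mult_single lookup_single when_def)
next
  case (add f g)
  then show ?case by (simp add: distrib_left lookup_add)
qed

section \<open>The group ring of a cyclic group\<close>

text \<open>The integral group ring of Z_p is represented by that of Z: \<open>cf p U i\<close> is the
  coefficient of a^i in the image of U.\<close>

definition cf :: "nat \<Rightarrow> (int \<Rightarrow>\<^sub>0 int) \<Rightarrow> int \<Rightarrow> int" where
  "cf p U i = (\<Sum>j\<in>Poly_Mapping.keys U. if int p dvd j - i then Poly_Mapping.lookup U j else 0)"

lemma cf_superset:
  assumes "finite K" "Poly_Mapping.keys U \<subseteq> K"
  shows "cf p U i = (\<Sum>j\<in>K. if int p dvd j - i then Poly_Mapping.lookup U j else 0)"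
  unfolding cf_def using assms by (intro sum.mono_neutral_left) (auto simp: in_keys_iff)

lemma cf_add: "cf p (U + V) i = cf p U i + cf p V i"
proof -
  let ?K = "Poly_Mapping.keys U \<union> Poly_Mapping.keys V"
  have "cf p (U + V) i = (\<Sum>j\<in>?K. if int p dvd j - i then Poly_Mapping.lookup (U + V) j else 0)"
    using keys_add[of U V] by (intro cf_superset) auto
  also have "\<dots> = (\<Sum>j\<in>?K. if int p dvd j - i then Poly_Mapping.lookup U j else 0)
      + (\<Sum>j\<in>?K. if int p dvd j - i then Poly_Mapping.lookup V j else 0)"
    unfolding sum.distrib[symmetric] by (intro sum.cong) (auto simp: lookup_add)
  finally show ?thesis by (subst (1 2) cf_superset[of ?K]) auto
qed

lemma cf_zero [simp]: "cf p 0 i = 0" by (simp add: cf_def)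

lemma cf_uminus: "cf p (- U) i = - cf p U i"
  using cf_add[of p U "- U" i] by simp

lemma cf_diff: "cf p (U - V) i = cf p U i - cf p V i"
  using cf_add[of p U "- V" i] by (simp add: cf_uminus)

lemma cf_sum: "cf p (\<Sum>x\<in>X. f x) i = (\<Sum>x\<in>X. cf p (f x) i)"
  by (induction X rule: infinite_finite_induct) (auto simp: cf_add)

lemma cf_single: "cf p (Poly_Mapping.single j c) i = (if int p dvd j - i then c else 0)"
  by (subst cf_superset[of "{j}"]) auto

lemma cf_index_cong: "int p dvd i - j \<Longrightarrow> cf p U i = cf p U j"
  unfolding cf_def
  by (intro sum.cong refl if_cong) (metis diff_add_cancel dvd_add_left_iff add_diff_eq)

lemma cf_mod [simp]: "cf p U (i mod int p) = cf p U i"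
  by (rule cf_index_cong) (simp add: mod_eq_dvd_iff[symmetric])

lemma cf_single_mult: "cf p (Poly_Mapping.single s c * U) i = c * cf p U (i - s)"
proof (induction U rule: poly_mapping_single_add_induct)
  case (single k d)
  have "s + k - i = k - (i - s)" by simp
  then show ?case by (simp only: mult_single cf_single) simp
next
  case (add f g)
  then show ?case by (simp add: distrib_left cf_add)
qed

lemma single_0_of_int: "Poly_Mapping.single 0 (of_int n) = of_int n"
  by (rule single_of_int)

lemma cf_of_int_mult: "cf p (of_int n * U) i = n * cf p U i"
  using cf_single_mult[of p 0 n U i] by (simp flip: single_0_of_int)

lemma cf_of_nat_mult: "cf p (of_nat n * U) i = int n * cf p U i"
  using cf_of_int_mult[of p "int n" U i] by simp

lemma cf_one: "cf p 1 i = (if int p dvd i then 1 else 0)"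
  using cf_single[of p 0 1 i] by simp

lemma cf_of_int: "cf p (of_int n) i = (if int p dvd i then n else 0)"
  using cf_of_int_mult[of p n 1 i] by (simp add: cf_one)

text \<open>This replaces a quotient construction: two representatives with the same folded
  coefficients are interchangeable as factors.\<close>

lemma cf_mult_cong:
  assumes "\<And>i. cf p U i = cf p U' i"
  shows "cf p (V * U) i = cf p (V * U') i"
proof (induction V rule: poly_mapping_single_add_induct)
  case (single k d)
  then show ?case by (simp add: cf_single_mult assms)
next
  case (add f g)
  then show ?case by (simp add: distrib_right cf_add)
qed

text \<open>\<open>cconst p q U\<close> says that U lies in the ideal generated by q and by the sum of all
  elements of Z_p.\<close>

definition cconst :: "nat \<Rightarrow> int \<Rightarrow> (int \<Rightarrow>\<^sub>0 int) \<Rightarrow> bool" where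
  "cconst p q U \<longleftrightarrow> (\<forall>i j. q dvd cf p U i - cf p U j)"

lemma cconst_cong: "(\<And>i. cf p U i = cf p V i) \<Longrightarrow> cconst p q U \<longleftrightarrow> cconst p q V"
  by (simp add: cconst_def)

lemma cconst_add: "cconst p q U \<Longrightarrow> cconst p q V \<Longrightarrow> cconst p q (U + V)"
  unfolding cconst_def cf_add by (simp add: add_diff_add)

lemma cconst_uminus: "cconst p q (- U) \<longleftrightarrow> cconst p q U"
  unfolding cconst_def cf_uminus by (simp add: dvd_diff_commute)

lemma cconst_diff: "cconst p q U \<Longrightarrow> cconst p q V \<Longrightarrow> cconst p q (U - V)"
  using cconst_add[of p q U "- V"] by (simp add: cconst_uminus)

lemma cconst_mult:
  assumes "cconst p q U"
  shows "cconst p q (V * U)"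
proof (induction V rule: poly_mapping_single_add_induct)
  case (single k d)
  then show ?case using assms
    by (simp add: cconst_def cf_single_mult flip: right_diff_distrib)
next
  case (add f g)
  then show ?case by (simp add: distrib_right cconst_add)
qed

lemma cconst_mult2: "cconst p q U \<Longrightarrow> cconst p q (U * V)"
  using cconst_mult[of p q U V] by (simp add: mult.commute)

lemma cconst_0: "cconst p 0 U \<Longrightarrow> cconst p q U"
  unfolding cconst_def by (metis dvd_0_left dvd_0_right)

lemma cconst_of_nat_dvd:
  assumes "of_nat n dvd U" shows "cconst p (int n) U"
proof -
  obtain V where "U = of_nat n * V" using assms by (rule dvdE)
  then have "cf p U i - cf p U j = int n * (cf p V i - cf p V j)" for i j
    by (simp add: cf_of_nat_mult right_diff_distrib)
  then show ?thesis by (simp add: cconst_def)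
qed

definition sm :: "int set \<Rightarrow> (int \<Rightarrow>\<^sub>0 int)" where
  "sm B = (\<Sum>k\<in>B. Poly_Mapping.single k 1)"

lemma cf_sm_mult: "cf p (sm B * U) i = (\<Sum>k\<in>B. cf p U (i - k))"
  by (simp add: sm_def sum_distrib_right cf_sum cf_single_mult)

lemma cf_sm:
  assumes "B \<subseteq> {0..<int p}"
  shows "cf p (sm B) i = (if i mod int p \<in> B then 1 else 0)"
proof -
  have fin: "finite B" using assms finite_subset by blast
  have "cf p (sm B) i = (\<Sum>k\<in>B. if k = i mod int p then 1 else 0)"
    unfolding sm_def cf_sum
  proof (intro sum.cong refl)
    fix k assume "k \<in> B"
    then have "k mod int p = k" using assms by auto
    then have "int p dvd k - i \<longleftrightarrow> k = i mod int p"
      by (metis mod_eq_dvd_iff)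
    then show "cf p (Poly_Mapping.single k 1) i = (if k = i mod int p then 1 else 0)"
      by (simp add: cf_single)
  qed
  then show ?thesis using fin by simp
qed

lemma cf_sm_full: "0 < p \<Longrightarrow> cf p (sm {0..<int p}) i = 1"
  by (simp add: cf_sm)

lemma cconst_sm_full: "0 < p \<Longrightarrow> cconst p 0 (sm {0..<int p})"
  by (simp add: cconst_def cf_sm_full)

text \<open>A proper nonempty set has a coefficient 1 and a coefficient 0, and the modulus divides
  their difference.\<close>

lemma cconst_sm:
  assumes "B \<subseteq> {0..<int p}" "cconst p q (sm B)" "B \<noteq> {}" "B \<noteq> {0..<int p}"
  shows "q dvd 1"
proof -
  obtain i j where "i \<in> B" "j \<in> {0..<int p}" "j \<notin> B" using assms by blast
  moreover from this have "cf p (sm B) i = 1" "cf p (sm B) j = 0"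
    using assms(1) by (auto simp: cf_sm)
  ultimately show ?thesis using assms(2) unfolding cconst_def by (metis diff_zero)
qed

text \<open>Modulo p the p-th power of \<open>sm B\<close> is the integer \<open>card B\<close>, hence a unit: so divisibility
  by higher and higher powers of p can be pushed through multiplication by \<open>sm B\<close>.\<close>

lemma cconst_cancel_sm:
  assumes p: "prime p" and B: "finite B" "\<not> p dvd card B"
    and BU: "cconst p 0 (sm B * U)"
  shows "cconst p 0 U"
proof -
  have p0: "0 < p" using p by (simp add: prime_gt_0_nat)
  \<comment> \<open>One step modulo p: the factor \<open>sm B\<close> is completed to
    \<open>sm B ^ p\<close>, which modulo p is \<open>card B\<close>, a unit.\<close>
  have *: "cconst p (int p) W" if W: "cconst p 0 (sm B * W)" for W
  proof -
    have pw: "sm B ^ p * W = sm B ^ (p - 1) * (sm B * W)"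
      using p0 by (cases p) (simp_all add: algebra_simps)
    have 1: "cconst p (int p) (sm B ^ p * W)"
      unfolding pw by (intro cconst_mult cconst_0[OF W])
    have "of_nat p dvd sm B ^ p - (\<Sum>k\<in>B. Poly_Mapping.single k (1::int) ^ p)"
      unfolding sm_def by (rule of_nat_prime_dvd_freshman_sum[OF p B(1)])
    then have "cconst p (int p) ((sm B ^ p - (\<Sum>k\<in>B. Poly_Mapping.single k (1::int) ^ p)) * W)"
      by (intro cconst_of_nat_dvd dvd_mult2)
    from cconst_diff[OF 1 this]
    have "cconst p (int p) ((\<Sum>k\<in>B. Poly_Mapping.single (int p * k) (1::int)) * W)"
      by (simp add: algebra_simps single_power)
    moreover have "cf p ((\<Sum>k\<in>B. Poly_Mapping.single (int p * k) (1::int)) * W) i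
        = int (card B) * cf p W i" for i
    proof -
      have "cf p W (i - int p * k) = cf p W i" for k by (rule cf_index_cong) simp
      then show ?thesis by (simp add: sum_distrib_right cf_sum cf_single_mult)
    qed
    ultimately have "int p dvd int (card B) * (cf p W i - cf p W j)" for i j
      by (simp add: cconst_def right_diff_distrib)
    moreover have "coprime (int p) (int (card B))"
      using p B(2) by (simp add: prime_imp_coprime)
    ultimately show ?thesis
      unfolding cconst_def by (metis coprime_dvd_mult_right_iff)
  qed
  have pow: "cconst p (int p ^ n) U" for n
  proof (induction n)
    case 0
    then show ?case by (simp add: cconst_def)
  next
    case (Suc n)
    \<comment> \<open>\<open>W\<close> is U minus \<open>cf p U 0\<close> times the sum of all
      elements, divided by \<open>p ^ n\<close>; the induction hypothesis makes the division
      exact.\<close>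
    define W where "W = (\<Sum>i\<in>{0..<int p}. Poly_Mapping.single i ((cf p U i - cf p U 0) div int p ^ n))"
    have W: "int p ^ n * cf p W i = cf p U i - cf p U 0" for i
    proof -
      have "cf p W i = (\<Sum>k\<in>{0..<int p}. if k = i mod int p
          then (cf p U k - cf p U 0) div int p ^ n else 0)"
        unfolding W_def cf_sum
      proof (intro sum.cong refl)
        fix k assume "k \<in> {0..<int p}"
        then have "int p dvd k - i \<longleftrightarrow> k = i mod int p" by (auto simp: mod_eq_dvd_iff[symmetric])
        then show "cf p (Poly_Mapping.single k ((cf p U k - cf p U 0) div int p ^ n)) i
          = (if k = i mod int p then (cf p U k - cf p U 0) div int p ^ n else 0)"
          by (simp add: cf_single)
      qed
      also have "\<dots> = (cf p U i - cf p U 0) div int p ^ n" using p0 by simp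
      finally show ?thesis using Suc by (simp add: cconst_def)
    qed
    let ?E = "of_int (cf p U 0) * sm {0..<int p}"
    have E: "cf p (of_int (int p ^ n) * W) i = cf p (U - ?E) i" for i
      using p0 by (simp only: cf_of_int_mult cf_diff cf_sm_full W)
    have "cconst p 0 (sm B * (U - ?E))"
      unfolding right_diff_distrib by (intro cconst_diff BU cconst_mult cconst_sm_full p0)
    then have "cconst p 0 (sm B * (of_int (int p ^ n) * W))"
      by (subst cconst_cong[OF cf_mult_cong[OF E]])
    then have "cconst p 0 (of_int (int p ^ n) * (sm B * W))"
      by (simp add: algebra_simps)
    then have "cconst p 0 (sm B * W)"
      using p0 by (simp add: cconst_def cf_of_int_mult del: of_int_power)
    from *[OF this] have "int p dvd cf p W i - cf p W j" for i j by (simp add: cconst_def)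
    then have "int p ^ n * int p dvd int p ^ n * cf p W i - int p ^ n * cf p W j" for i j
      by (simp flip: right_diff_distrib)
    then show ?case unfolding W by (simp add: cconst_def mult.commute)
  qed
  have "cf p U i = cf p U j" for i j
  proof (rule ccontr)
    assume ne: "cf p U i \<noteq> cf p U j"
    \<comment> \<open>The exponent d is large enough because
      \<open>p ^ d >= 2 ^ d > d\<close>.\<close>
    define d where "d = \<bar>cf p U i - cf p U j\<bar>"
    have "int p ^ nat d dvd d" using pow[of "nat d"] by (simp add: cconst_def d_def)
    moreover have "0 < d" using ne by (simp add: d_def)
    ultimately have "int p ^ nat d \<le> d" by (simp add: zdvd_imp_le)
    moreover have "int (nat d) < int (2 ^ nat d)" by (simp only: of_nat_less_iff less_exp)
    then have "d < 2 ^ nat d" using \<open>0 < d\<close> by simp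
    moreover have "(2::int) ^ nat d \<le> int p ^ nat d"
      using prime_ge_2_nat[OF p] by (intro power_mono) auto
    ultimately show False by linarith
  qed
  then show ?thesis by (simp add: cconst_def)
qed

text \<open>The augmentation is multiplicative: a shift permutes the residues modulo p.\<close>

lemma sum_cf_sm_mult:
  assumes "0 < p"
  shows "(\<Sum>i\<in>{0..<int p}. cf p (sm B * U) i) = int (card B) * (\<Sum>i\<in>{0..<int p}. cf p U i)"
proof -
  have shift: "(\<Sum>i\<in>{0..<int p}. cf p U (i - k)) = (\<Sum>i\<in>{0..<int p}. cf p U i)" for k
  proof (rule sum.reindex_bij_witness[where i = "\<lambda>i. (i + k) mod int p" and j = "\<lambda>i. (i - k) mod int p"])
    fix a assume "a \<in> {0..<int p}"
    then show "((a - k) mod int p + k) mod int p = a" "((a + k) mod int p - k) mod int p = a"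
      by (simp_all add: mod_simps)
  qed (use assms in auto)
  show ?thesis
    by (simp only: cf_sm_mult sum.swap[of _ B] shift) simp
qed

text \<open>Since \<open>l ^ e = 1\<close> modulo p, each element of Z_p equals its own power with
  exponent \<open>l ^ e\<close>, so the congruence modulo l returns \<open>B\<close> itself.\<close>

lemma cf_sm_power_congruent:
  assumes l: "prime l" and B: "B \<subseteq> {0..<int p}" and N: "l ^ e mod p = 1"
  shows "int l dvd cf p (sm B ^ (l ^ e)) i - cf p (sm B) i"
proof -
  have fin: "finite B" using B finite_subset by blast
  have "of_nat l dvd sm B ^ (l ^ e) - (\<Sum>k\<in>B. Poly_Mapping.single k (1::int) ^ (l ^ e))"
    unfolding sm_def by (rule of_nat_prime_dvd_freshman_sum_power[OF l fin])
  then obtain V where V: "sm B ^ (l ^ e) - (\<Sum>k\<in>B. Poly_Mapping.single k (1::int) ^ (l ^ e)) = of_nat l * V"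
    by (rule dvdE)
  have "cf p (\<Sum>k\<in>B. Poly_Mapping.single k (1::int) ^ (l ^ e)) i = cf p (sm B) i"
    unfolding sm_def cf_sum
  proof (intro sum.cong refl)
    fix k
    have "int p dvd int (l ^ e) - 1"
      using N by (metis mod_eq_dvd_iff mod_mod_trivial of_nat_1 of_nat_mod)
    then have "int p dvd (int (l ^ e) - 1) * k" by (rule dvd_mult2)
    then have "int p dvd int (l ^ e) * k - i - (k - i)" by (simp add: algebra_simps)
    then have "int p dvd int (l ^ e) * k - i \<longleftrightarrow> int p dvd k - i"
      by (metis diff_add_cancel dvd_add_right_iff)
    then show "cf p (Poly_Mapping.single k (1::int) ^ (l ^ e)) i = cf p (Poly_Mapping.single k 1) i"
      by (simp add: single_power cf_single)
  qed
  then have "cf p (sm B ^ (l ^ e)) i - cf p (sm B) i = int l * cf p V i"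
    by (metis V cf_diff cf_of_nat_mult)
  then show ?thesis by simp
qed

text \<open>Modulo the sum of all elements, B times its inverse is an integer n, and the powers of B with exponent
  l^(p-1) are integer multiples a B with a = 1 modulo l. If l divided n, it would divide B. Hence n = 1.\<close>

lemma card_difference_set:
  assumes p: "prime p" and B: "B \<subseteq> {0..<int p}" "B \<noteq> {}" "B \<noteq> {0..<int p}"
    and diff: "\<And>i. cf p (sm B * sm ((\<lambda>k. (- k) mod int p) ` B)) i = (if int p dvd i then n else 0) + c"
    and pow: "\<And>N. N mod p = 1 \<Longrightarrow> \<exists>a b. \<forall>i. cf p (sm B ^ N) i = a * cf p (sm B) i + b"
  shows "card B = 1 \<or> card B = p - 1"
proof -
  define B' where "B' = (\<lambda>k. (- k) mod int p) ` B"
  define k where "k = int (card B)"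
  have p0: "0 < p" and p1: "1 < p" using p prime_gt_1_nat by (auto simp: prime_gt_0_nat)
  have fin: "finite B" using B finite_subset by blast
  have card_less: "card B < p"
  proof -
    have "card B < card {0..<int p}" using B by (intro psubset_card_mono) auto
    then show ?thesis by simp
  qed
  have card_pos: "0 < card B" using fin B by (simp add: card_gt_0_iff)
  have ndvd: "\<not> p dvd card B" using card_less card_pos by (simp add: nat_dvd_not_less)
  have B': "B' \<subseteq> {0..<int p}" using p0 by (auto simp: B'_def)
  have inj: "inj_on (\<lambda>k. (- k) mod int p) B"
  proof (rule inj_onI)
    fix x y assume "x \<in> B" "y \<in> B" "- x mod int p = - y mod int p"
    then have "int p dvd - x + y" by (metis mod_eq_dvd_iff diff_minus_eq_add)
    then have "int p dvd y - x" by simp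
    then have "y mod int p = x mod int p" by (simp add: mod_eq_dvd_iff)
    then show "x = y" using \<open>x \<in> B\<close> \<open>y \<in> B\<close> B by (metis atLeastLessThan_iff mod_pos_pos_trivial subsetD)
  qed
  have cardB': "card B' = card B" unfolding B'_def by (rule card_image[OF inj])
  have B'ne: "B' \<noteq> {}" "B' \<noteq> {0..<int p}" using cardB' card_less card_pos by auto
  have mem: "(- x) mod int p \<in> B'" if "x \<in> B" for x using that by (simp add: B'_def)
  \<comment> \<open>At the identity of Z_p the coefficient is the number of elements of B.\<close>
  have "cf p (sm B * sm B') 0 = (\<Sum>x\<in>B. 1)"
    unfolding cf_sm_mult by (intro sum.cong refl) (use mem B' in \<open>simp add: cf_sm\<close>)
  then have k0: "k = n + c" using diff[of 0] by (simp add: k_def B'_def)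
  have "cf p (sm B * sm B') 1 \<le> (\<Sum>x\<in>B. 1)"
    unfolding cf_sm_mult by (intro sum_mono) (use B' in \<open>simp add: cf_sm\<close>)
  moreover have "\<not> int p dvd 1" using p1 by simp
  ultimately have "c \<le> k" using diff[of 1] by (simp add: k_def B'_def)
  then have n0: "0 \<le> n" using k0 by simp
  \<comment> \<open>Counting all pairs gives a second relation between k, n and c.\<close>
  have ksq: "k * k = n + int p * c"
  proof -
    have "(\<Sum>i\<in>{0..<int p}. cf p (sm B * sm B') i) = k * (\<Sum>i\<in>{0..<int p}. cf p (sm B') i)"
      unfolding k_def by (rule sum_cf_sm_mult[OF p0])
    also have "(\<Sum>i\<in>{0..<int p}. cf p (sm B') i) = (\<Sum>i\<in>{0..<int p}. if i \<in> B' then 1 else 0)"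
      by (intro sum.cong refl) (use B' in \<open>simp add: cf_sm\<close>)
    also have "\<dots> = int (card B')"
      using B' by (simp add: sum.If_cases Int_absorb1)
    finally have "k * k = (\<Sum>i\<in>{0..<int p}. cf p (sm B * sm B') i)" by (simp add: cardB' k_def)
    also have "\<dots> = (\<Sum>i\<in>{0..<int p}. (if i = 0 then n else 0) + c)"
      unfolding B'_def diff by (intro sum.cong refl) (auto dest: zdvd_imp_le)
    also have "\<dots> = n + int p * c" using p0 by (simp add: sum.distrib)
    finally show ?thesis .
  qed
  have np: "\<not> int p dvd n"
  proof
    assume "int p dvd n"
    then have "int p dvd k * k" unfolding ksq by simp
    then have "int p dvd k" using p by (simp add: prime_dvd_mult_iff)
    then show False using ndvd by (simp add: k_def)
  qed
  have nl: "\<not> int l dvd n" if l: "prime l" for l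
  proof (cases "l = p")
    case False
    \<comment> \<open>By Fermat this exponent is 1 modulo p, and as a power of l it admits the
      congruence modulo l.\<close>
    define N where "N = l ^ (p - 1)"
    have "coprime l p" using primes_coprime[OF l p False] .
    then have "[N = 1] (mod p)" unfolding N_def
      using euler_theorem[of l p] p by (simp add: totient_prime)
    then have N: "N mod p = 1" using p1 by (simp add: cong_def)
    have "N \<noteq> 1" unfolding N_def using prime_gt_1_nat[OF l] p1 by (simp add: nat_power_eq_Suc_0_iff)
    moreover have "N \<noteq> 0" unfolding N_def using prime_gt_0_nat[OF l] by simp
    \<comment> \<open>Two factors are split off: one is to be cancelled, the other to meet
      \<open>sm B'\<close>.\<close>
    ultimately obtain M where M: "N = Suc (Suc M)" by (metis not0_implies_Suc One_nat_def)
    obtain a b where ab: "\<And>i. cf p (sm B ^ N) i = a * cf p (sm B) i + b" using pow[OF N] by auto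
    obtain i j where ij: "i \<in> B" "j \<in> {0..<int p}" "j \<notin> B" using B by blast
    from this have "cf p (sm B) i = 1" "cf p (sm B) j = 0" using B by (auto simp: cf_sm)
    moreover have "int l dvd (cf p (sm B ^ N) i - cf p (sm B) i) - (cf p (sm B ^ N) j - cf p (sm B) j)"
      unfolding N_def by (intro dvd_diff cf_sm_power_congruent l B N[unfolded N_def])
    \<comment> \<open>Between a point of B and a point outside, the coefficient of
      \<open>sm B ^ N\<close> drops by a, and modulo l it drops by 1.\<close>
    ultimately have la: "int l dvd a - 1" unfolding ab by simp
    have "cconst p 0 (sm B * (sm B ^ Suc M - of_int a))"
      using ab M by (simp add: cconst_def right_diff_distrib cf_diff mult.commute[of _ "of_int a"] cf_of_int_mult)
    then have "cconst p 0 (sm B ^ Suc M - of_int a)"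
      by (rule cconst_cancel_sm[OF p fin ndvd])
    then have 1: "cconst p (int l) ((sm B ^ Suc M - of_int a) * sm B')"
      by (rule cconst_mult2[OF cconst_0])
    show ?thesis
    proof
      assume "int l dvd n"
      then have "cconst p (int l) (sm B * sm B')"
        using diff by (simp add: cconst_def B'_def)
      then have 2: "cconst p (int l) (sm B ^ M * (sm B * sm B'))" by (rule cconst_mult)
      from cconst_diff[OF 2 1] have "cconst p (int l) (of_int a * sm B')"
        by (simp add: algebra_simps)
      then have "int l dvd a * (cf p (sm B') i - cf p (sm B') j)" for i j
        by (simp add: cconst_def cf_of_int_mult right_diff_distrib)
      moreover have "coprime (int l) a"
      proof (rule prime_imp_coprime)
        show "\<not> int l dvd a"
        proof
          assume "int l dvd a"
          from dvd_diff[OF this la] show False using prime_gt_1_nat[OF l] by simp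
        qed
      qed (use l in simp)
      ultimately have "cconst p (int l) (sm B')"
        unfolding cconst_def by (metis coprime_dvd_mult_right_iff)
      then have "int l dvd 1" using B' B'ne cconst_sm by blast
      then show False using prime_gt_1_nat[OF l] by simp
    qed
  qed (use np in simp)
  have "n = 1"
  proof (rule ccontr)
    assume "n \<noteq> 1"
    then have "nat n \<noteq> 1" using n0 by simp
    then obtain l where "prime l" "l dvd nat n" using prime_factor_nat by blast
    then show False using nl[of l] n0 by (metis int_dvd_int_iff int_nat_eq)
  qed
  \<comment> \<open>Here \<open>c = k - 1\<close>, and the quadratic equation for k has the roots 1
    and \<open>p - 1\<close>.\<close>
  then have "k * k = 1 + int p * (k - 1)" using ksq k0 by simp
  then have "(k - 1) * (k + 1 - int p) = 0" by (simp add: algebra_simps)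
  then have "k = 1 \<or> k = int p - 1" by auto
  then show ?thesis using p0 by (auto simp: k_def)
qed

section \<open>The group ring of Z x Z_p and its Schur subrings\<close>

text \<open>Elements of the group ring are Laurent polynomials in z with coefficients in the group
  ring of Z_p; \<open>gf p f (m, k)\<close> is the coefficient of z^m a^k.\<close>

type_synonym grp_ring = "int \<Rightarrow>\<^sub>0 (int \<Rightarrow>\<^sub>0 int)"

definition gf :: "nat \<Rightarrow> grp_ring \<Rightarrow> int \<times> int \<Rightarrow> int" where
  "gf p f x = cf p (Poly_Mapping.lookup f (fst x)) (snd x)"

definition mn :: "int \<times> int \<Rightarrow> grp_ring" where
  "mn g = Poly_Mapping.single (fst g) (Poly_Mapping.single (snd g) 1)"

definition bar :: "(int \<times> int) set \<Rightarrow> grp_ring" where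
  "bar X = (\<Sum>g\<in>X. mn g)"

definition lay :: "nat \<Rightarrow> int set \<Rightarrow> (int \<times> int) set" where
  "lay p M = {(m, k). m \<in> M \<and> 0 \<le> k \<and> k < int p}"

lemma gf_add: "gf p (f + g) x = gf p f x + gf p g x"
  by (simp add: gf_def lookup_add cf_add)

lemma gf_diff: "gf p (f - g) x = gf p f x - gf p g x"
  by (simp add: gf_def lookup_minus cf_diff)

lemma gf_sum: "gf p (\<Sum>i\<in>I. f i) x = (\<Sum>i\<in>I. gf p (f i) x)"
  by (simp add: gf_def lookup_sum cf_sum)

lemma gf_mod [simp]: "gf p f (m, k mod int p) = gf p f (m, k)"
  by (simp add: gf_def)

lemma lookup_of_int_mult:
  fixes f :: grp_ring
  shows "Poly_Mapping.lookup (of_int c * f) m = of_int c * Poly_Mapping.lookup f m"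
  using lookup_single_mult[of 0 "of_int c" f m] by (simp only: single_of_int diff_0_right)

lemma gf_of_int_mult: "gf p (of_int c * f) x = c * gf p f x"
  by (simp add: gf_def lookup_of_int_mult cf_of_int_mult)

lemma gf_of_nat_mult: "gf p (of_nat c * f) x = int c * gf p f x"
  using gf_of_int_mult[of p "int c" f x] by simp

lemma gf_single: "gf p (Poly_Mapping.single j U) (m, k) = (if m = j then cf p U k else 0)"
  by (simp add: gf_def lookup_single when_def)

lemma mn_mult: "mn g * mn h = mn (fst g + fst h, snd g + snd h)"
  by (simp add: mn_def mult_single)

lemma mn_power: "mn g ^ n = mn (int n * fst g, int n * snd g)"
  by (simp add: mn_def single_power)

lemma gf_mn: "gf p (mn g) x = (if fst x = fst g \<and> int p dvd snd g - snd x then 1 else 0)"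
  by (simp add: gf_def mn_def lookup_single when_def cf_single)

lemma gf_mn_Gc:
  assumes "0 < p" "x \<in> Gc p"
  shows "gf p (mn g) x = (if (fst g, snd g mod int p) = x then 1 else 0)"
proof -
  have "int p dvd snd g - snd x \<longleftrightarrow> snd g mod int p = snd x"
    using assms by (auto simp: Gc_def simp flip: mod_eq_dvd_iff)
  then show ?thesis by (auto simp: gf_mn prod_eq_iff)
qed

lemma gf_bar:
  assumes "0 < p" "finite X" "X \<subseteq> Gc p" "x \<in> Gc p"
  shows "gf p (bar X) x = (if x \<in> X then 1 else 0)"
proof -
  have "gf p (bar X) x = (\<Sum>g\<in>X. if g = x then 1 else 0)"
    unfolding bar_def gf_sum
  proof (intro sum.cong refl)
    fix g assume "g \<in> X"
    then have "(fst g, snd g mod int p) = g" using assms by (auto simp: Gc_def)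
    then show "gf p (mn g) x = (if g = x then 1 else 0)" by (simp add: gf_mn_Gc assms)
  qed
  then show ?thesis using assms(2) by simp
qed

lemma gf_eqI:
  assumes "0 < p" "\<And>x. x \<in> Gc p \<Longrightarrow> gf p f x = gf p f' x"
  shows "gf p f x = gf p f' x"
proof -
  obtain m k where x: "x = (m, k)" by (cases x)
  have "gf p f (m, k mod int p) = gf p f' (m, k mod int p)"
    using assms by (intro assms(2)) (simp add: Gc_def)
  then show ?thesis by (simp add: x)
qed

lemma gf_mult_cong:
  assumes "\<And>x. gf p f x = gf p f' x"
  shows "gf p (h * f) x = gf p (h * f') x"
proof (induction h rule: poly_mapping_single_add_induct)
  case (single i U)
  have "cf p (Poly_Mapping.lookup f m) k = cf p (Poly_Mapping.lookup f' m) k" for m k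
    using assms[of "(m, k)"] by (simp add: gf_def)
  then show ?case unfolding gf_def lookup_single_mult by (rule cf_mult_cong)
next
  case (add f g)
  then show ?case by (simp add: distrib_right gf_add)
qed

lemma finite_gf: "0 < p \<Longrightarrow> finite {x \<in> Gc p. gf p f x \<noteq> 0}"
  by (rule finite_subset[of _ "Poly_Mapping.keys f \<times> {0..<int p}"])
    (auto simp: Gc_def gf_def in_keys_iff)

lemma lay_subset: "lay p M \<subseteq> Gc p"
  by (auto simp: lay_def Gc_def)

lemma finite_lay: "finite M \<Longrightarrow> finite (lay p M)"
  by (rule finite_subset[of _ "M \<times> {0..<int p}"]) (auto simp: lay_def)

lemma ginv_Gc: "0 < p \<Longrightarrow> g \<in> Gc p \<Longrightarrow> ginv p g \<in> Gc p"
  by (auto simp: ginv_def Gc_def)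

lemma ginv_ginv: "g \<in> Gc p \<Longrightarrow> ginv p (ginv p g) = g"
  by (auto simp: ginv_def Gc_def mod_simps)

section \<open>Integral elements of a Schur ring\<close>

text \<open>The span condition over the field is replaced by constancy of the counts on each class,
  so that all computations can be made with integers.\<close>

locale schur_partition =
  fixes p :: nat and \<D> :: "(int \<times> int) set set"
  assumes p: "prime p"
    and ne: "C \<in> \<D> \<Longrightarrow> C \<noteq> {}"
    and fin: "C \<in> \<D> \<Longrightarrow> finite C"
    and sub: "C \<in> \<D> \<Longrightarrow> C \<subseteq> Gc p"
    and disj: "C \<in> \<D> \<Longrightarrow> E \<in> \<D> \<Longrightarrow> x \<in> C \<Longrightarrow> x \<in> E \<Longrightarrow> C = E"
    and cover: "\<Union>\<D> = Gc p"
    and unit: "{gone} \<in> \<D>"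
    and inv: "C \<in> \<D> \<Longrightarrow> ginv p ` C \<in> \<D>"
    and structure_const: "C \<in> \<D> \<Longrightarrow> C' \<in> \<D> \<Longrightarrow> E \<in> \<D> \<Longrightarrow> x \<in> E \<Longrightarrow> y \<in> E \<Longrightarrow>
      card {(c, d). c \<in> C \<and> d \<in> C' \<and> gmul p c d = x} = card {(c, d). c \<in> C \<and> d \<in> C' \<and> gmul p c d = y}"
begin

lemma p0: "0 < p" using p by (simp add: prime_gt_0_nat)
lemma p1: "1 < p" using p by (rule prime_gt_1_nat)

abbreviation mon :: "int \<Rightarrow> (int \<Rightarrow>\<^sub>0 int) \<Rightarrow> grp_ring" where "mon \<equiv> Poly_Mapping.single"
abbreviation A :: "int \<Rightarrow>\<^sub>0 int" where "A \<equiv> sm {0..<int p}"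

text \<open>These are the elements of the Schur ring with integer coefficients.\<close>

definition Sel :: "grp_ring \<Rightarrow> bool" where
  "Sel f \<longleftrightarrow> (\<forall>C\<in>\<D>. \<forall>x\<in>C. \<forall>y\<in>C. gf p f x = gf p f y)"

definition Sset :: "(int \<times> int) set \<Rightarrow> bool" where
  "Sset X \<longleftrightarrow> X \<subseteq> Gc p \<and> (\<forall>C\<in>\<D>. C \<subseteq> X \<or> C \<inter> X = {})"

lemma SelD: "Sel f \<Longrightarrow> C \<in> \<D> \<Longrightarrow> x \<in> C \<Longrightarrow> y \<in> C \<Longrightarrow> gf p f x = gf p f y"
  unfolding Sel_def by blast

lemma SelI: "(\<And>C x y. C \<in> \<D> \<Longrightarrow> x \<in> C \<Longrightarrow> y \<in> C \<Longrightarrow> gf p f x = gf p f y) \<Longrightarrow> Sel f"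
  unfolding Sel_def by blast

lemma SsetD: "Sset X \<Longrightarrow> C \<in> \<D> \<Longrightarrow> x \<in> C \<Longrightarrow> x \<in> X \<Longrightarrow> y \<in> C \<Longrightarrow> y \<in> X"
  by (auto simp: Sset_def)

lemma Sset_iff:
  assumes "Sset X" "C \<in> \<D>" "x \<in> C" "y \<in> C" shows "x \<in> X \<longleftrightarrow> y \<in> X"
  using SsetD[OF assms(1,2), of x y] SsetD[OF assms(1,2), of y x] assms(3,4) by auto

lemma Sset_sub: "Sset X \<Longrightarrow> X \<subseteq> Gc p" by (simp add: Sset_def)

lemma class_of: assumes "x \<in> Gc p" obtains C where "C \<in> \<D>" "x \<in> C"
  using assms cover by blast

lemma Sset_class: "C \<in> \<D> \<Longrightarrow> Sset C"
  unfolding Sset_def using sub[of C] disj[of C] by (metis disjoint_iff order_refl)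

lemma Sset_Int: "Sset X \<Longrightarrow> Sset Y \<Longrightarrow> Sset (X \<inter> Y)"
  unfolding Sset_def by blast

lemma Sset_Un: "Sset X \<Longrightarrow> Sset Y \<Longrightarrow> Sset (X \<union> Y)"
  unfolding Sset_def by blast

lemma Sset_Diff: "Sset X \<Longrightarrow> Sset Y \<Longrightarrow> Sset (X - Y)"
  unfolding Sset_def by blast

lemma Sset_ginv:
  assumes "Sset X" shows "Sset (ginv p ` X)"
proof -
  have "ginv p ` X \<subseteq> Gc p" using assms p0 by (auto simp: Sset_def ginv_Gc)
  moreover have "y \<in> ginv p ` X" if C: "C \<in> \<D>" "x \<in> C" "x \<in> ginv p ` X" "y \<in> C" for C x y
  proof -
    obtain x' where x': "x' \<in> X" "x = ginv p x'" using C(3) by (rule imageE)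
    then have "ginv p x = x'" using assms by (auto simp: Sset_def ginv_ginv)
    then have x'C: "x' \<in> ginv p ` C" using C(2) by (metis imageI)
    have "ginv p y \<in> X"
      by (rule SsetD[OF assms inv[OF C(1)] x'C x'(1) imageI[OF C(4)]])
    moreover have "ginv p (ginv p y) = y" using C(1,4) sub[of C] by (auto intro: ginv_ginv)
    ultimately show ?thesis by (metis imageI)
  qed
  ultimately show ?thesis unfolding Sset_def by blast
qed

lemma Sel_cong:
  assumes "\<And>x. x \<in> Gc p \<Longrightarrow> gf p f x = gf p f' x"
  shows "Sel f \<longleftrightarrow> Sel f'"
proof -
  have "gf p f x = gf p f' x" if "C \<in> \<D>" "x \<in> C" for C x
    using assms sub[OF that(1)] that(2) by blast
  then show ?thesis by (metis SelI SelD)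
qed

lemma Sel_of_int_mult: "Sel f \<Longrightarrow> Sel (of_int c * f)"
proof (rule SelI)
  fix C x y assume "Sel f" "C \<in> \<D>" "x \<in> C" "y \<in> C"
  then have "gf p f x = gf p f y" by (rule SelD)
  then show "gf p (of_int c * f) x = gf p (of_int c * f) y" by (simp only: gf_of_int_mult)
qed

lemma Sel_sum:
  assumes "\<And>i. i \<in> I \<Longrightarrow> Sel (f i)"
  shows "Sel (\<Sum>i\<in>I. f i)"
proof (rule SelI)
  fix C x y assume "C \<in> \<D>" "x \<in> C" "y \<in> C"
  then show "gf p (\<Sum>i\<in>I. f i) x = gf p (\<Sum>i\<in>I. f i) y"
    unfolding gf_sum by (intro sum.cong refl SelD[OF assms])
qed

text \<open>This cuts a layer, or a pair of opposite layers, out of a product.\<close>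

lemma Sel_restrict:
  assumes "Sel f" "Sset X" "\<And>x. x \<in> Gc p \<Longrightarrow> gf p h x = (if x \<in> X then gf p f x else 0)"
  shows "Sel h"
proof (rule SelI)
  fix C x y assume C: "C \<in> \<D>" "x \<in> C" "y \<in> C"
  then have "x \<in> Gc p" "y \<in> Gc p" using sub[OF C(1)] by auto
  moreover have "x \<in> X \<longleftrightarrow> y \<in> X" by (rule Sset_iff[OF assms(2) C])
  ultimately show "gf p h x = gf p h y" using SelD[OF assms(1) C] by (simp add: assms(3))
qed

lemma Sel_lay:
  assumes "Sel f" "Sset (lay p M)"
    "\<And>m. Poly_Mapping.lookup h m = (if m \<in> M then Poly_Mapping.lookup f m else 0)"
  shows "Sel h"
  by (rule Sel_restrict[OF assms(1,2)]) (auto simp: gf_def assms(3) lay_def Gc_def)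

text \<open>The Schur-Wielandt principle. \<open>P\<close> will be equality with a value,
  non-vanishing, or non-divisibility by a prime.\<close>

lemma Sset_level:
  assumes "Sel f" shows "Sset {x \<in> Gc p. P (gf p f x)}"
proof -
  have "P (gf p f x) \<longleftrightarrow> P (gf p f y)" if "C \<in> \<D>" "x \<in> C" "y \<in> C" for C x y
    by (subst SelD[OF assms that]) (rule refl)
  then show ?thesis unfolding Sset_def using sub by blast
qed

lemma Sel_bar:
  assumes "finite X" "Sset X" shows "Sel (bar X)"
proof (rule SelI)
  fix C x y assume C: "C \<in> \<D>" "x \<in> C" "y \<in> C"
  then have "x \<in> Gc p" "y \<in> Gc p" using sub[OF C(1)] by auto
  moreover have "x \<in> X \<longleftrightarrow> y \<in> X" by (rule Sset_iff[OF assms(2) C])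
  ultimately show "gf p (bar X) x = gf p (bar X) y"
    by (simp only: gf_bar[OF p0 assms(1) Sset_sub[OF assms(2)]])
qed

lemma Sel_one: "Sel 1"
proof -
  have "Sel (bar {gone})" by (rule Sel_bar[OF _ Sset_class[OF unit]]) simp
  then show ?thesis by (simp add: bar_def mn_def gone_def)
qed

lemma Sel_bar_mult:
  assumes "C \<in> \<D>" "C' \<in> \<D>" shows "Sel (bar C * bar C')"
proof -
  have eq: "gf p (bar C * bar C') x = int (card {(c, d). c \<in> C \<and> d \<in> C' \<and> gmul p c d = x})"
    if x: "x \<in> Gc p" for x
  proof -
    have "gf p (bar C * bar C') x = (\<Sum>(c, d)\<in>C \<times> C'. if gmul p c d = x then 1 else 0)"
      unfolding bar_def sum_product sum.cartesian_product gf_sum mn_mult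
      by (intro sum.cong refl) (auto simp: gf_mn_Gc[OF p0 x] gmul_def)
    also have "\<dots> = (\<Sum>y\<in>C \<times> C'. if (case y of (c, d) \<Rightarrow> gmul p c d = x) then 1 else 0)"
      by (intro sum.cong) auto
    also have "\<dots> = int (card ((C \<times> C') \<inter> {(c, d). gmul p c d = x}))"
      using assms fin by (subst sum.If_cases) (auto simp: case_prod_unfold)
    also have "(C \<times> C') \<inter> {(c, d). gmul p c d = x} = {(c, d). c \<in> C \<and> d \<in> C' \<and> gmul p c d = x}"
      by auto
    finally show ?thesis .
  qed
  show ?thesis
  proof (rule SelI)
    fix E x y assume E: "E \<in> \<D>" "x \<in> E" "y \<in> E"
    then have "x \<in> Gc p" "y \<in> Gc p" using sub[OF E(1)] by auto
    then show "gf p (bar C * bar C') x = gf p (bar C * bar C') y"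
      using structure_const[OF assms E] by (simp add: eq)
  qed
qed

lemma Sel_expand:
  assumes "Sel f"
  obtains T c where "finite T" "T \<subseteq> \<D>" "\<And>x. gf p f x = gf p (\<Sum>C\<in>T. of_int (c C) * bar C) x"
proof -
  define T where "T = {C \<in> \<D>. \<exists>x\<in>C. gf p f x \<noteq> 0}"
  define c where "c C = gf p f (SOME x. x \<in> C)" for C
  \<comment> \<open>Every member of T is the class of some point in the finite support of f.\<close>
  have "T \<subseteq> (\<lambda>x. THE C. C \<in> \<D> \<and> x \<in> C) ` {x \<in> Gc p. gf p f x \<noteq> 0}"
  proof
    fix C assume "C \<in> T"
    then obtain x where x: "C \<in> \<D>" "x \<in> C" "gf p f x \<noteq> 0" by (auto simp: T_def)
    have "(THE C. C \<in> \<D> \<and> x \<in> C) = C"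
    proof (rule the_equality)
      show "E = C" if "E \<in> \<D> \<and> x \<in> E" for E
        using that x disj[of E C x] by simp
    qed (use x in simp)
    then show "C \<in> (\<lambda>x. THE C. C \<in> \<D> \<and> x \<in> C) ` {x \<in> Gc p. gf p f x \<noteq> 0}"
      using x sub[OF x(1)] by (intro image_eqI[of _ _ x]) auto
  qed
  then have finT: "finite T" using finite_gf[OF p0, of f] finite_surj by blast
  moreover have "T \<subseteq> \<D>" by (auto simp: T_def)
  moreover have "gf p f x = gf p (\<Sum>C\<in>T. of_int (c C) * bar C) x" for x
  proof (rule gf_eqI[OF p0])
    fix x assume x: "x \<in> Gc p"
    then obtain E where E: "E \<in> \<D>" "x \<in> E" by (rule class_of)
    have cE: "c E = gf p f x"
      unfolding c_def by (rule SelD[OF assms E(1) someI E(2)]) (rule E(2))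
    have "gf p (\<Sum>C\<in>T. of_int (c C) * bar C) x = (\<Sum>C\<in>T. if C = E then c C else 0)"
      unfolding gf_sum
    proof (intro sum.cong refl)
      fix C assume "C \<in> T"
      then have C: "C \<in> \<D>" by (simp add: T_def)
      then have "x \<in> C \<longleftrightarrow> C = E" using E disj[OF C E(1) _ E(2)] by auto
      then show "gf p (of_int (c C) * bar C) x = (if C = E then c C else 0)"
        using C x p0 by (simp add: gf_of_int_mult gf_bar fin sub)
    qed
    also have "\<dots> = gf p f x"
      using finT cE E by (auto simp: T_def)
    finally show "gf p f x = gf p (\<Sum>C\<in>T. of_int (c C) * bar C) x" by simp
  qed
  ultimately show ?thesis by (rule that)
qed

text \<open>Both factors are expanded into class sums. The expansions hold for folded coefficients
  only, so the factors are replaced one at a time.\<close>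

lemma Sel_mult:
  assumes "Sel f" "Sel g" shows "Sel (f * g)"
proof -
  obtain T c where T: "T \<subseteq> \<D>" "\<And>x. gf p f x = gf p (\<Sum>C\<in>T. of_int (c C) * bar C) x"
    using Sel_expand[OF assms(1)] by metis
  obtain U d where U: "U \<subseteq> \<D>" "\<And>x. gf p g x = gf p (\<Sum>C\<in>U. of_int (d C) * bar C) x"
    using Sel_expand[OF assms(2)] by metis
  let ?f = "\<Sum>C\<in>T. of_int (c C) * bar C" and ?g = "\<Sum>C\<in>U. of_int (d C) * bar C"
  have "gf p (f * g) x = gf p (?f * ?g) x" for x
  proof -
    have "gf p (f * g) x = gf p (f * ?g) x" by (rule gf_mult_cong[OF U(2)])
    also have "\<dots> = gf p (?g * f) x" by (simp add: mult.commute)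
    also have "\<dots> = gf p (?g * ?f) x" by (rule gf_mult_cong[OF T(2)])
    finally show ?thesis by (simp add: mult.commute)
  qed
  moreover have "Sel (?f * ?g)"
    unfolding sum_product
  proof (intro Sel_sum)
    fix C C' assume "C \<in> T" "C' \<in> U"
    then have "Sel (of_int (c C * d C') * (bar C * bar C'))"
      using T U by (intro Sel_of_int_mult Sel_bar_mult) auto
    then show "Sel (of_int (c C) * bar C * (of_int (d C') * bar C'))"
      by (simp add: algebra_simps)
  qed
  ultimately show ?thesis using Sel_cong by blast
qed

lemma Sel_power: "Sel f \<Longrightarrow> Sel (f ^ n)"
  by (induction n) (simp_all add: Sel_one Sel_mult)


section \<open>Layers\<close>

lemma Sel_ind:
  assumes "finite X" "Sset X" "\<And>x. x \<in> Gc p \<Longrightarrow> gf p f x = (if x \<in> X then 1 else 0)"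
  shows "Sel f"
proof -
  have "gf p f x = gf p (bar X) x" if "x \<in> Gc p" for x
    using assms(3)[OF that] gf_bar[OF p0 assms(1) Sset_sub[OF assms(2)] that] by simp
  then show ?thesis using Sel_bar[OF assms(1,2)] Sel_cong[of f "bar X"] by blast
qed

lemma Sset_ind:
  assumes "Sel f" "X \<subseteq> Gc p" "\<And>x. x \<in> Gc p \<Longrightarrow> x \<in> X \<longleftrightarrow> P (gf p f x)"
  shows "Sset X"
proof -
  have "X = {x \<in> Gc p. P (gf p f x)}" using assms(2,3) by auto
  then show ?thesis using Sset_level[OF assms(1)] by simp
qed

lemma Sel_of_int_cancel:
  assumes "Sel (of_int c * f)" "c \<noteq> 0" shows "Sel f"
proof (rule SelI)
  fix C x y assume "C \<in> \<D>" "x \<in> C" "y \<in> C"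
  then have "gf p (of_int c * f) x = gf p (of_int c * f) y" by (rule SelD[OF assms(1)])
  then show "gf p f x = gf p f y" using assms(2) by (simp add: gf_of_int_mult)
qed

lemma gf_numeral_mult: "gf p (numeral n * f) x = numeral n * gf p f x"
  using gf_of_int_mult[of p "numeral n" f x] by simp

lemma cf_A_mult_A: "cf p (A * A) i = int p"
  using p0 by (simp add: cf_sm_mult cf_sm_full)

lemma mem_lay: "x \<in> Gc p \<Longrightarrow> x \<in> lay p M \<longleftrightarrow> fst x \<in> M"
  by (auto simp: Gc_def lay_def)

lemma Sel_mon_A:
  assumes "Sset (lay p {j})" shows "Sel (mon j A)"
proof (rule Sel_ind[OF finite_lay assms])
  fix x assume "x \<in> Gc p"
  then show "gf p (mon j A) x = (if x \<in> lay p {j} then 1 else 0)"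
    using p0 by (cases x) (simp add: mem_lay gf_single cf_sm_full)
qed simp

lemma Sset_lay_mon:
  assumes "Sel (mon j U)" "\<And>i. cf p U i \<noteq> 0" shows "Sset (lay p {j})"
proof (rule Sset_ind[OF assms(1) lay_subset])
  fix x assume "x \<in> Gc p"
  then show "x \<in> lay p {j} \<longleftrightarrow> gf p (mon j U) x \<noteq> 0"
    using assms(2) by (cases x) (simp add: mem_lay gf_single)
qed

text \<open>In Z_p the square of A is p times A, so the product of two full layers is supported
  exactly on the layer \<open>i + j\<close>.\<close>

lemma Sset_lay_add:
  assumes "Sset (lay p {i})" "Sset (lay p {j})" shows "Sset (lay p {i + j})"
proof (rule Sset_lay_mon)
  show "Sel (mon (i + j) (A * A))"
    using Sel_mult[OF Sel_mon_A[OF assms(1)] Sel_mon_A[OF assms(2)]] by (simp add: mult_single)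
qed (use p0 in \<open>simp add: cf_A_mult_A\<close>)

lemma Sset_lay_uminus:
  assumes "Sset (lay p {i})" shows "Sset (lay p {- i})"
proof -
  have "ginv p ` lay p {i} = lay p {- i}"
  proof (intro subset_antisym subsetI)
    fix x assume x: "x \<in> lay p {- i}"
    then have "ginv p x \<in> lay p {i}" using p0 by (auto simp: lay_def ginv_def)
    moreover have "ginv p (ginv p x) = x" using x lay_subset by (blast intro: ginv_ginv)
    ultimately show "x \<in> ginv p ` lay p {i}" by (metis imageI)
  qed (use p0 in \<open>auto simp: lay_def ginv_def\<close>)
  then show ?thesis using Sset_ginv[OF assms] by simp
qed

lemma Sset_lay_all:
  assumes "Sset (lay p {1})" shows "Sset (lay p {j})"
proof -
  have zero: "Sset (lay p {0})" using Sset_lay_add[OF assms Sset_lay_uminus[OF assms]] by simp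
  have nat: "Sset (lay p {int n})" for n
  proof (induction n)
    case 0
    then show ?case using zero by simp
  next
    case (Suc n)
    from Sset_lay_add[OF assms this] show ?case by simp
  qed
  show ?thesis
    by (cases j rule: int_cases2) (simp_all only: nat Sset_lay_uminus[OF nat])
qed

lemma fold_mult:
  "(mon i U + mon (- i) V) * (mon j P + mon (- j) Q) =
    mon (i + j) (U * P) + mon (i - j) (U * Q) + mon (j - i) (V * P) + mon (- (i + j)) (V * Q)"
  by (simp add: distrib_left distrib_right mult_single)

lemma Sel_fold_A:
  assumes "Sset (lay p {j, - j})" "j \<noteq> 0" shows "Sel (mon j A + mon (- j) A)"
proof (rule Sel_ind[OF finite_lay assms(1)])
  fix x assume "x \<in> Gc p"
  then show "gf p (mon j A + mon (- j) A) x = (if x \<in> lay p {j, - j} then 1 else 0)"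
    using p0 assms(2) by (cases x) (auto simp add: mem_lay gf_single cf_sm_full gf_add)
qed simp

text \<open>A Chebyshev-like recursion: if f_i is the sum of the full layers i and -i, then f_1 f_i
  = p (f_(i+1) + f_(i-1)), and the pair i - 1, already known, is removed. Hence the induction
  carries two consecutive pairs.\<close>

lemma Sset_fold_all:
  assumes "Sset (lay p {1, - 1})" shows "Sset (lay p {j, - j})"
proof -
  have f: "Sel (mon 1 A + mon (- 1) A)" using Sel_fold_A[OF assms] by simp
  \<comment> \<open>In the square the layer 0 arises twice, so it is the level set of the value
    \<open>2 * p\<close>.\<close>
  have sq: "Sset (lay p {0})"
  proof (rule Sset_ind[OF Sel_mult[OF f f] lay_subset])
    fix x assume "x \<in> Gc p"
    then show "x \<in> lay p {0} \<longleftrightarrow> gf p ((mon 1 A + mon (- 1) A) * (mon 1 A + mon (- 1) A)) x = 2 * int p"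
      unfolding fold_mult using p0
      by (cases x) (auto simp: mem_lay gf_single cf_A_mult_A gf_add gf_numeral_mult)
  qed
  have nat: "Sset (lay p {int n, - int n}) \<and> Sset (lay p {int (Suc n), - int (Suc n)})" for n
  proof (induction n)
    case 0
    then show ?case using sq assms by simp
  next
    case (Suc n)
    define i where "i = int (Suc n)"
    have "Sel (mon i A + mon (- i) A)"
      unfolding i_def by (rule Sel_fold_A[OF conjunct2[OF Suc]]) simp
    then have g: "Sel ((mon 1 A + mon (- 1) A) * (mon i A + mon (- i) A))" by (rule Sel_mult[OF f])
    have i1: "1 \<le> i" by (simp add: i_def)
    have "Sset (lay p {1 + i, - (1 + i), 1 - i, i - 1})"
    proof (rule Sset_ind[OF g lay_subset])
      fix x assume "x \<in> Gc p"
      then show "x \<in> lay p {1 + i, - (1 + i), 1 - i, i - 1} \<longleftrightarrow>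
          gf p ((mon 1 A + mon (- 1) A) * (mon i A + mon (- i) A)) x \<noteq> 0"
        unfolding fold_mult using p0 i1
        by (cases x) (auto simp: mem_lay gf_single cf_A_mult_A gf_add)
    qed
    then have "Sset (lay p {1 + i, - (1 + i), 1 - i, i - 1} - lay p {int n, - int n})"
      using conjunct1[OF Suc] by (rule Sset_Diff)
    also have "lay p {1 + i, - (1 + i), 1 - i, i - 1} - lay p {int n, - int n} = lay p {1 + i, - (1 + i)}"
      by (auto simp: lay_def i_def)
    finally have "Sset (lay p {int (Suc (Suc n)), - int (Suc (Suc n))})" by (simp add: i_def)
    then show ?case using conjunct2[OF Suc] by blast
  qed
  show ?thesis by (cases j rule: int_cases2) (use nat in \<open>auto simp: insert_commute\<close>)
qed

text \<open>Of the four layers of the product the inner ones, \<open>i - j\<close> and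
  \<open>j - i\<close>, are discarded; they differ from the outer ones because i and j are
  positive.\<close>

lemma Sel_fold_prod_add:
  assumes "Sset (lay p {i + j, - (i + j)})" "1 \<le> i" "1 \<le> j"
    and "Sel (mon i U + mon (- i) V)" "Sel (mon j P + mon (- j) Q)"
  shows "Sel (mon (i + j) (U * P) + mon (- (i + j)) (V * Q))"
  using assms(2,3)
  by (intro Sel_lay[OF Sel_mult[OF assms(4,5)] assms(1)])
    (unfold fold_mult, auto simp: lookup_add lookup_single when_def)

text \<open>Now the inner layers are kept. For \<open>i = j\<close> both summands lie in the layer
  0.\<close>

lemma Sel_fold_prod_diff:
  assumes "Sset (lay p {i - j, - (i - j)})" "1 \<le> i" "1 \<le> j"
    and "Sel (mon i U + mon (- i) V)" "Sel (mon j P + mon (- j) Q)"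
  shows "Sel (mon (i - j) (U * Q) + mon (j - i) (V * P))"
  using assms(2,3)
  by (intro Sel_lay[OF Sel_mult[OF assms(4,5)] assms(1)])
    (unfold fold_mult, auto simp: lookup_add lookup_single when_def)

lemma Sel_single_class:
  assumes "Sset {(m, 0)}" shows "Sel (mon m 1)"
proof (rule Sel_ind[OF _ assms])
  fix x assume "x \<in> Gc p"
  then show "gf p (mon m 1) x = (if x \<in> {(m, 0)} then 1 else 0)"
    by (cases x) (auto simp: gf_single cf_one Gc_def dest: zdvd_imp_le)
qed simp

text \<open>The subgroup generated by z^p meets a layer in at most one point; hence separated layers
  make its elements singleton classes.\<close>

lemma Sset_p_power:
  assumes K: "Sset {(int p * m, 0) | m. True}" and "Sset (lay p {int p * m})"
  shows "Sset {(int p * m, 0)}"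
proof -
  have "{(int p * m, 0)} = {(int p * m, 0) | m. True} \<inter> lay p {int p * m}"
    using p0 by (auto simp: lay_def)
  then show ?thesis using Sset_Int[OF assms] by simp
qed

lemma Sel_p_power_fold:
  assumes K: "Sset {(int p * m, 0) | m. True}" and "Sset (lay p {int p * m, - (int p * m)})" "m \<noteq> 0"
  shows "Sel (mon (int p * m) 1 + mon (- (int p * m)) 1)"
proof (rule Sel_ind)
  have "{(int p * m, 0), (- (int p * m), 0)} = {(int p * m, 0) | m. True} \<inter> lay p {int p * m, - (int p * m)}"
  proof -
    have "\<exists>m'. - (int p * m) = int p * m'" by (rule exI[of _ "- m"]) simp
    then show ?thesis using p0 by (auto simp: lay_def)
  qed
  then show "Sset {(int p * m, 0), (- (int p * m), 0)}" using Sset_Int[OF assms(1,2)] by simp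
  fix x assume "x \<in> Gc p"
  then show "gf p (mon (int p * m) 1 + mon (- (int p * m)) 1) x
      = (if x \<in> {(int p * m, 0), (- (int p * m), 0)} then 1 else 0)"
    using p0 assms(3) by (cases x) (auto simp: gf_single gf_add cf_one Gc_def dest: zdvd_imp_le)
qed simp

section \<open>Two classes in the layer of z: difference sets\<close>

text \<open>\<open>b\<close> is the value off \<open>B\<close> in the layer 1, and \<open>a\<close>
  the difference between the values on and off \<open>B\<close>. The classes may reach into other
  layers, as they do when layers are linked.\<close>

lemma two_classes_coeffs:
  assumes C: "C1 \<in> \<D>" "C2 \<in> \<D>" and B: "B \<subseteq> {0..<int p}" "B \<noteq> {}" "B \<noteq> {0..<int p}"
    and C1: "\<And>k. k \<in> B \<Longrightarrow> (1, k) \<in> C1"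
    and C2: "\<And>k. k \<in> {0..<int p} - B \<Longrightarrow> (1, k) \<in> C2"
    and f: "Sel f"
  shows "\<exists>a b. \<forall>i. cf p (Poly_Mapping.lookup f 1) i = a * cf p (sm B) i + b"
proof -
  obtain i0 j0 where ij: "i0 \<in> B" "j0 \<in> {0..<int p} - B" using B by blast
  let ?u = "\<lambda>i. cf p (Poly_Mapping.lookup f 1) i"
  have 1: "?u i = ?u i0" if "i \<in> B" for i
    using SelD[OF f C(1) C1[OF that] C1[OF ij(1)]] by (simp add: gf_def)
  have 2: "?u i = ?u j0" if "i \<in> {0..<int p} - B" for i
    using SelD[OF f C(2) C2[OF that] C2[OF ij(2)]] by (simp add: gf_def)
  have "?u i = (?u i0 - ?u j0) * cf p (sm B) i + ?u j0" for i
  proof -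
    have "i mod int p \<in> {0..<int p}" using p0 by simp
    then have "?u (i mod int p) = (if i mod int p \<in> B then ?u i0 else ?u j0)"
      using 1[of "i mod int p"] 2[of "i mod int p"] by auto
    then show ?thesis using B by (simp add: cf_sm)
  qed
  then show ?thesis by blast
qed

text \<open>The Schur ring has no classes in Z_p besides {1} and its complement.\<close>

definition triv0 :: bool where
  "triv0 \<longleftrightarrow> (\<forall>U. Sel (mon 0 U) \<longrightarrow> (\<exists>n c. \<forall>i. cf p U i = (if int p dvd i then n else 0) + c))"

text \<open>The three assumptions are what separated and linked layers share. By the first one
  \<open>B * (U - a)\<close> is constant, and cancelling \<open>B\<close> leaves
  \<open>U = a\<close> modulo the sum of all elements. Applied to the product of \<open>B\<close>
  and its inverse, this yields the n and c of a difference set.\<close>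

lemma two_class_core:
  assumes B: "B \<subseteq> {0..<int p}" "B \<noteq> {}" "B \<noteq> {0..<int p}"
    and module: "\<And>U. Sel (mon 0 U) \<Longrightarrow> \<exists>a b. \<forall>i. cf p (sm B * U) i = a * cf p (sm B) i + b"
    and diff: "Sel (mon 0 (sm B * sm ((\<lambda>k. (- k) mod int p) ` B)))"
    and pow: "\<And>N. N mod p = 1 \<Longrightarrow> \<exists>a b. \<forall>i. cf p (sm B ^ N) i = a * cf p (sm B) i + b"
  shows "triv0" "card B = 1 \<or> card B = p - 1"
proof -
  have fin: "finite B" using B finite_subset by blast
  have "card B < card {0..<int p}" using B by (intro psubset_card_mono) auto
  moreover have "0 < card B" using fin B by (simp add: card_gt_0_iff)
  ultimately have ndvd: "\<not> p dvd card B" by (simp add: nat_dvd_not_less)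
  show triv: triv0 unfolding triv0_def
  proof (intro allI impI)
    fix U assume "Sel (mon 0 U)"
    then obtain a b where ab: "\<And>i. cf p (sm B * U) i = a * cf p (sm B) i + b" using module by blast
    have "cconst p 0 (sm B * (U - of_int a))"
      using ab by (simp add: cconst_def right_diff_distrib cf_diff mult.commute[of _ "of_int a"] cf_of_int_mult)
    then have "cconst p 0 (U - of_int a)" by (rule cconst_cancel_sm[OF p fin ndvd])
    then have "cf p (U - of_int a) i = cf p (U - of_int a) 0" for i
      by (simp add: cconst_def)
    moreover have "cf p U i = (if int p dvd i then a else 0) + cf p (U - of_int a) i" for i
      by (simp add: cf_diff cf_of_int)
    ultimately have "cf p U i = (if int p dvd i then a else 0) + cf p (U - of_int a) 0" for i
      by simp
    then show "\<exists>n c. \<forall>i. cf p U i = (if int p dvd i then n else 0) + c" by blast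
  qed
  obtain n c where "\<And>i. cf p (sm B * sm ((\<lambda>k. (- k) mod int p) ` B)) i = (if int p dvd i then n else 0) + c"
    using triv[unfolded triv0_def, rule_format, OF diff] by blast
  then show "card B = 1 \<or> card B = p - 1" by (rule card_difference_set[OF p B _ pow])
qed

lemma Sel_mon_sm:
  assumes "Sset ({j} \<times> B)" "B \<subseteq> {0..<int p}" shows "Sel (mon j (sm B))"
proof (rule Sel_ind[OF _ assms(1)])
  show "finite ({j} \<times> B)" using assms(2) finite_subset by blast
  fix x assume "x \<in> Gc p"
  then show "gf p (mon j (sm B)) x = (if x \<in> {j} \<times> B then 1 else 0)"
    using assms(2) by (cases x) (auto simp: gf_single cf_sm Gc_def)
qed

lemma Sel_fold_sm:
  assumes "Sset ({j} \<times> B \<union> {- j} \<times> E)" "B \<subseteq> {0..<int p}" "E \<subseteq> {0..<int p}" "j \<noteq> 0"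
  shows "Sel (mon j (sm B) + mon (- j) (sm E))"
proof (rule Sel_ind[OF _ assms(1)])
  have "finite B" "finite E" using assms(2,3) finite_subset by blast+
  then show "finite ({j} \<times> B \<union> {- j} \<times> E)" by simp
  fix x assume "x \<in> Gc p"
  then show "gf p (mon j (sm B) + mon (- j) (sm E)) x = (if x \<in> {j} \<times> B \<union> {- j} \<times> E then 1 else 0)"
    using assms(2-4) by (cases x) (auto simp: gf_single gf_add cf_sm Gc_def)
qed

lemma ginv_times: "ginv p ` ({j} \<times> B) = {- j} \<times> ((\<lambda>k. (- k) mod int p) ` B)"
  by (force simp: ginv_def)

lemma one_layer_core:
  assumes C: "{1} \<times> B \<in> \<D>" "{1} \<times> ({0..<int p} - B) \<in> \<D>" and B: "B \<subseteq> {0..<int p}"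
    and K: "Sset {(int p * m, 0) | m. True}" and L: "\<And>j. Sset (lay p {j})"
  shows "triv0" "card B = 1 \<or> card B = p - 1"
proof -
  have B1: "B \<noteq> {}" "B \<noteq> {0..<int p}" using ne[OF C(1)] ne[OF C(2)] by auto
  have coeffs: "\<exists>a b. \<forall>i. cf p U i = a * cf p (sm B) i + b" if "Sel (mon 1 U)" for U
    using two_classes_coeffs[OF C B B1 _ _ that] by simp
  let ?B' = "(\<lambda>k. (- k) mod int p) ` B"
  have f: "Sel (mon 1 (sm B))" by (rule Sel_mon_sm[OF Sset_class[OF C(1)] B])
  have f': "Sel (mon (- 1) (sm ?B'))"
  proof (rule Sel_mon_sm)
    show "Sset ({- 1} \<times> ?B')" using Sset_class[OF inv[OF C(1)]] by (simp only: ginv_times)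
  qed (use p0 in auto)
  have module: "\<exists>a b. \<forall>i. cf p (sm B * U) i = a * cf p (sm B) i + b" if "Sel (mon 0 U)" for U
    using coeffs[of "sm B * U"] Sel_mult[OF f that] by (simp add: mult_single)
  have diff: "Sel (mon 0 (sm B * sm ?B'))"
    using Sel_mult[OF f f'] by (simp add: mult_single)
  have pow: "\<exists>a b. \<forall>i. cf p (sm B ^ N) i = a * cf p (sm B) i + b" if "N mod p = 1" for N
  proof (rule coeffs)
    have "int N mod int p = 1" using that by (metis of_nat_1 of_nat_mod)
    then have "int p dvd 1 - int N" using p1 by (simp flip: mod_eq_dvd_iff)
    \<comment> \<open>The shift by z^(pm) undoes the change of layer caused by the N-th
      power.\<close>
    then obtain m where m: "1 - int N = int p * m" by (rule dvdE)
    have "Sel (mon (int N) (sm B ^ N))" using Sel_power[OF f, of N] by (simp add: single_power)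
    from Sel_mult[OF this Sel_single_class[OF Sset_p_power[OF K L, of m]]]
    show "Sel (mon 1 (sm B ^ N))" by (simp add: mult_single flip: m)
  qed
  show "triv0" by (rule two_class_core(1)[OF B B1 module diff pow])
  show "card B = 1 \<or> card B = p - 1" by (rule two_class_core(2)[OF B B1 module diff pow])
qed

text \<open>Linked layers only provide sums over two opposite layers, so each product is followed by
  a choice of layers. The part in the negative layer is carried along, and \<open>coeffs\<close>
  finally reads off the layer 1.\<close>

lemma two_layer_core:
  fixes B B'
  defines "B' \<equiv> (\<lambda>k. (- k) mod int p) ` B"
  assumes C: "{1} \<times> B \<union> {- 1} \<times> B' \<in> \<D>" "C2 \<in> \<D>" "\<And>k. k \<in> {0..<int p} - B \<Longrightarrow> (1, k) \<in> C2"
    and B: "B \<subseteq> {0..<int p}" "B \<noteq> {}" "B \<noteq> {0..<int p}"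
    and K: "Sset {(int p * m, 0) | m. True}" and L: "\<And>j. Sset (lay p {j, - j})"
  shows "triv0" "card B = 1 \<or> card B = p - 1"
proof -
  have B': "B' \<subseteq> {0..<int p}" using p0 by (auto simp: B'_def)
  have coeffs: "\<exists>a b. \<forall>i. cf p U i = a * cf p (sm B) i + b" if "Sel (mon 1 U + mon (- 1) V)" for U V
    using two_classes_coeffs[OF C(1,2) B _ C(3) that] by (simp add: lookup_add lookup_single)
  have f: "Sel (mon 1 (sm B) + mon (- 1) (sm B'))"
    using Sel_fold_sm[OF Sset_class[OF C(1)] B(1) B'] by simp
  have module: "\<exists>a b. \<forall>i. cf p (sm B * U) i = a * cf p (sm B) i + b" if "Sel (mon 0 U)" for U
    using coeffs[of "sm B * U"] Sel_mult[OF f that] by (simp add: mult_single distrib_right)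
  have diff: "Sel (mon 0 (sm B * sm B'))"
  proof -
    \<comment> \<open>The two inner products fall into the layer 0 and agree; the factor 2 is then
      divided out.\<close>
    have "Sel (mon (1 - 1) (sm B * sm B') + mon (1 - 1) (sm B' * sm B))"
      by (rule Sel_fold_prod_diff[OF L _ _ f f]) simp_all
    then have "Sel (of_int 2 * mon 0 (sm B * sm B'))" by (simp add: mult.commute[of "sm B'"])
    then show ?thesis by (rule Sel_of_int_cancel) simp
  qed
  have pow: "\<exists>a b. \<forall>i. cf p (sm B ^ N) i = a * cf p (sm B) i + b" if N: "N mod p = 1" for N
  proof (cases "N = 1")
    case True
    then show ?thesis by (intro exI[of _ 1] exI[of _ 0]) simp
  next
    case False
    have "N \<noteq> 0" using N by (cases N) auto
    \<comment> \<open>Now \<open>N - 1\<close> is positive too, as the product rules for pairs of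
      layers require.\<close>
    then have N2: "2 \<le> N" using False by simp
    have "int N mod int p = 1" using N by (metis of_nat_1 of_nat_mod)
    then have "int p dvd int N - 1" using p1 by (simp flip: mod_eq_dvd_iff)
    then obtain m where m: "int N - 1 = int p * m" by (rule dvdE)
    have powf: "Sel (mon (int (Suc n)) (sm B ^ Suc n) + mon (- int (Suc n)) (sm B' ^ Suc n))" for n
    proof (induction n)
      case 0
      then show ?case using f by simp
    next
      case (Suc n)
      have "Sel (mon (1 + int (Suc n)) (sm B * sm B ^ Suc n) + mon (- (1 + int (Suc n))) (sm B' * sm B' ^ Suc n))"
        by (rule Sel_fold_prod_add[OF L _ _ f Suc]) simp_all
      then show ?case by simp
    qed
    have "Sel (mon (int N) (sm B ^ N) + mon (- int N) (sm B' ^ N))"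
      using powf[of "N - 1"] N2 by (simp del: power_Suc)
    moreover have "m \<noteq> 0" using m N2 by auto
    then have "Sel (mon (int N - 1) 1 + mon (- (int N - 1)) 1)"
      unfolding m by (intro Sel_p_power_fold[OF K L])
    \<comment> \<open>As p divides \<open>N - 1\<close>, the pair at \<open>N - 1\<close> is a known
      element; the inner layers of the product are 1 and -1.\<close>
    ultimately have "Sel (mon (int N - (int N - 1)) (sm B ^ N * 1) + mon (int N - 1 - int N) (sm B' ^ N * 1))"
      using N2 by (intro Sel_fold_prod_diff[OF L]) auto
    then have "Sel (mon 1 (sm B ^ N) + mon (- 1) (sm B' ^ N))" by simp
    then show ?thesis by (rule coeffs)
  qed
  show "triv0" by (rule two_class_core(1)[OF B module diff[unfolded B'_def] pow])
  show "card B = 1 \<or> card B = p - 1" by (rule two_class_core(2)[OF B module diff[unfolded B'_def] pow])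
qed


section \<open>The partition into classes\<close>

definition same :: "int \<times> int \<Rightarrow> int \<times> int \<Rightarrow> bool" where
  "same g h \<longleftrightarrow> (\<exists>C\<in>\<D>. g \<in> C \<and> h \<in> C)"

lemma same_Sel: "same g h \<Longrightarrow> Sel f \<Longrightarrow> gf p f g = gf p f h"
  unfolding same_def by (blast dest: SelD)

lemma same_Sset: "same g h \<Longrightarrow> Sset X \<Longrightarrow> g \<in> X \<longleftrightarrow> h \<in> X"
  unfolding same_def by (blast dest: Sset_iff)

lemma same_refl: "g \<in> Gc p \<Longrightarrow> same g g"
  unfolding same_def using class_of by blast

lemma same_Gc: "same g h \<Longrightarrow> g \<in> Gc p" "same g h \<Longrightarrow> h \<in> Gc p"
  unfolding same_def using sub by blast+

lemma same_trans: "same g h \<Longrightarrow> same h k \<Longrightarrow> same g k"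
  unfolding same_def by (metis disj)

lemma sameI:
  assumes "g \<in> Gc p" "h \<in> Gc p"
    and "\<And>C. C \<in> \<D> \<Longrightarrow> g \<in> C \<Longrightarrow> gf p (bar C) g = gf p (bar C) h"
  shows "same g h"
proof -
  obtain C where C: "C \<in> \<D>" "g \<in> C" using assms(1) by (rule class_of)
  have "h \<in> C"
    using assms(3)[OF C] C(2) gf_bar[OF p0 fin[OF C(1)] sub[OF C(1)]] assms(1,2)
    by (simp split: if_splits)
  then show ?thesis using C unfolding same_def by blast
qed

lemma Sel_bar_class: "C \<in> \<D> \<Longrightarrow> Sel (bar C)"
  by (intro Sel_bar fin Sset_class)

lemma Sel_layer:
  assumes "Sel f" "Sset (lay p {m})" shows "Sel (mon m (Poly_Mapping.lookup f m))"
  by (rule Sel_lay[OF assms]) (simp add: lookup_single when_def)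

lemma Sel_layer_fold:
  assumes "Sel f" "Sset (lay p {m, - m})" "m \<noteq> 0"
  shows "Sel (mon m (Poly_Mapping.lookup f m) + mon (- m) (Poly_Mapping.lookup f (- m)))"
  by (rule Sel_lay[OF assms(1,2)]) (use assms(3) in \<open>auto simp: lookup_single lookup_add when_def\<close>)

lemma same_fst:
  assumes "same g h" "Sset (lay p {fst g})" shows "fst g = fst h"
  using same_Sset[OF assms] same_Gc[OF assms(1)] by (simp add: mem_lay)

lemma same_fst_fold:
  assumes "same g h" "Sset (lay p {fst g, - fst g})" shows "\<bar>fst g\<bar> = \<bar>fst h\<bar>"
  using same_Sset[OF assms] same_Gc[OF assms(1)] by (auto simp: mem_lay)

lemma sm_singleton: "sm {s} = Poly_Mapping.single s 1"
  by (simp add: sm_def)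

text \<open>The powers of the singleton class w = (1, s) carry the layer 0 to all others, so by
  \<open>triv0\<close> each layer m splits into w^m and the rest.\<close>

lemma same_one_layer:
  assumes L: "\<And>j. Sset (lay p {j})" and s: "{(1, s)} \<in> \<D>" and triv: triv0
    and g: "g \<in> Gc p" and h: "h \<in> Gc p"
  shows "same g h \<longleftrightarrow> fst g = fst h \<and> (int p dvd snd g - s * fst g \<longleftrightarrow> int p dvd snd h - s * fst h)"
proof -
  have s_range: "0 \<le> s" "s < int p" using sub[OF s] by (auto simp: Gc_def)
  have w: "Sel (mon 1 (Poly_Mapping.single s 1))"
    using Sel_mon_sm[of 1 "{s}"] Sset_class[OF s] s_range by (simp add: sm_singleton)
  have w': "Sel (mon (- 1) (Poly_Mapping.single (- s) 1))"
  proof (rule Sel_ind)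
    show "Sset {(- 1, (- s) mod int p)}" using Sset_class[OF inv[OF s]] by (simp add: ginv_def)
    fix x assume x: "x \<in> Gc p"
    then show "gf p (mon (- 1) (Poly_Mapping.single (- s) 1)) x = (if x \<in> {(- 1, (- s) mod int p)} then 1 else 0)"
      using gf_mn_Gc[OF p0 x, of "(- 1, - s)"] by (simp add: mn_def eq_commute)
  qed simp
  have W: "Sel (mon j (Poly_Mapping.single (s * j) 1))" for j
  proof (cases j rule: int_cases2)
    case (nonneg n)
    then show ?thesis using Sel_power[OF w, of n] by (simp add: single_power mult.commute)
  next
    case (nonpos n)
    then show ?thesis using Sel_power[OF w', of n] by (simp add: single_power mult.commute)
  qed
  show ?thesis
  proof
    assume gh: "same g h"
    have fst: "fst g = fst h" by (rule same_fst[OF gh L])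
    have "gf p (mon (fst g) (Poly_Mapping.single (s * fst g) 1)) g
        = gf p (mon (fst g) (Poly_Mapping.single (s * fst g) 1)) h"
      by (rule same_Sel[OF gh W])
    then have "int p dvd s * fst g - snd g \<longleftrightarrow> int p dvd s * fst h - snd h"
      by (simp add: gf_def cf_single fst split: if_splits)
    then show "fst g = fst h \<and> (int p dvd snd g - s * fst g \<longleftrightarrow> int p dvd snd h - s * fst h)"
      using fst by (simp add: dvd_diff_commute)
  next
    assume gh: "fst g = fst h \<and> (int p dvd snd g - s * fst g \<longleftrightarrow> int p dvd snd h - s * fst h)"
    define m where "m = fst g"
    show "same g h"
    proof (rule sameI[OF g h])
      fix C assume "C \<in> \<D>"
      define U where "U = Poly_Mapping.lookup (bar C) m"
      have "Sel (mon m U)" unfolding U_def by (rule Sel_layer[OF Sel_bar_class[OF \<open>C \<in> \<D>\<close>] L])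
      from Sel_mult[OF W[of "- m"] this] have "Sel (mon 0 (Poly_Mapping.single (- (s * m)) 1 * U))"
        by (simp add: mult_single)
      then obtain n c where
        "\<And>i. cf p (Poly_Mapping.single (- (s * m)) 1 * U) i = (if int p dvd i then n else 0) + c"
        using triv unfolding triv0_def by blast
      then have nc: "cf p U (i + s * m) = (if int p dvd i then n else 0) + c" for i
        by (simp add: cf_single_mult)
      have U: "cf p U k = (if int p dvd k - s * m then n else 0) + c" for k
        using nc[of "k - s * m"] by simp
      have e: "fst h = m" "int p dvd snd g - s * m \<longleftrightarrow> int p dvd snd h - s * m"
        using gh by (auto simp: m_def)
      show "gf p (bar C) g = gf p (bar C) h"
        unfolding gf_def m_def[symmetric] e(1) U_def[symmetric] U e(2) ..
    qed
  qed
qed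

text \<open>With w = (1, s) and w' = (-1, s'), \<open>\<delta> x\<close> says that x is a power of
  w, or of w' if its first coordinate is negative. For j > 0 the layers j and -j split into {w^j,
  w'^j} and the rest.\<close>

lemma same_two_layer:
  assumes L: "\<And>j. Sset (lay p {j, - j})" and triv: triv0
    and C: "{(1, s), (- 1, s')} \<in> \<D>" "C2 \<in> \<D>" "{(1, s), (- 1, s')} \<union> C2 = lay p {1, - 1}"
    and c: "int p dvd s + s' \<or> p = 2"
    and g: "g \<in> Gc p" and h: "h \<in> Gc p"
  defines "\<delta> \<equiv> \<lambda>x. int p dvd snd x - (if 0 \<le> fst x then s * fst x else - s' * fst x)"
  shows "same g h \<longleftrightarrow> \<bar>fst g\<bar> = \<bar>fst h\<bar> \<and> (\<delta> g \<longleftrightarrow> \<delta> h)"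
proof -
  have rng: "0 \<le> s" "s < int p" "0 \<le> s'" "s' < int p" using sub[OF C(1)] by (auto simp: Gc_def)
  have C2: "C2 = lay p {1, - 1} - {(1, s), (- 1, s')}"
  proof -
    have "C2 \<noteq> {(1, s), (- 1, s')}"
    proof
      assume "C2 = {(1, s), (- 1, s')}"
      then have "lay p {1, - 1} = {(1, s), (- 1, s')}" using C(3) by simp
      moreover have "(1, (s + 1) mod int p) \<in> lay p {1, - 1}" using p0 by (simp add: lay_def)
      ultimately have "(s + 1) mod int p = s" by auto
      then have "(s + 1) mod int p = s mod int p" using rng by simp
      then have "int p dvd (s + 1) - s" by (simp only: mod_eq_dvd_iff)
      then show False using p1 by simp
    qed
    then have "C2 \<inter> {(1, s), (- 1, s')} = {}" using disj[OF C(2,1)] by blast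
    then show ?thesis using C(3) by blast
  qed
  have w: "Sel (mon 1 (Poly_Mapping.single s 1) + mon (- 1) (Poly_Mapping.single s' 1))"
    using Sel_fold_sm[of 1 "{s}" "{s'}"] Sset_class[OF C(1)] rng
    by (simp add: sm_singleton insert_commute)
  \<comment> \<open>As the inner layers are dropped, only w^j and w'^j remain, without mixed
    products.\<close>
  have W: "Sel (mon (int (Suc n)) (Poly_Mapping.single (s * int (Suc n)) 1)
      + mon (- int (Suc n)) (Poly_Mapping.single (s' * int (Suc n)) 1))" for n
  proof (induction n)
    case 0
    then show ?case using w by simp
  next
    case (Suc n)
    have "Sel (mon (1 + int (Suc n)) (Poly_Mapping.single s 1 * Poly_Mapping.single (s * int (Suc n)) 1)
        + mon (- (1 + int (Suc n))) (Poly_Mapping.single s' 1 * Poly_Mapping.single (s' * int (Suc n)) 1))"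
      by (rule Sel_fold_prod_add[OF L _ _ w Suc]) simp_all
    then show ?case by (simp add: mult_single algebra_simps)
  qed
  have W1: "Sel (mon j (Poly_Mapping.single (s * j) 1) + mon (- j) (Poly_Mapping.single (s' * j) 1))"
    if "1 \<le> j" for j
  proof -
    have "j = int (Suc (nat (j - 1)))" using that by simp
    then show ?thesis using W[of "nat (j - 1)"] by metis
  qed
  have one: "\<exists>n b. \<forall>k. cf p U k = (if int p dvd k - s then n else 0) + b
        \<and> cf p V k = (if int p dvd k - s' then n else 0) + b"
    if f: "Sel (mon 1 U + mon (- 1) V)" for U V
  proof -
    have gfU: "gf p (mon 1 U + mon (- 1) V) (1, k) = cf p U k"
      and gfV: "gf p (mon 1 U + mon (- 1) V) (- 1, k) = cf p V k" for k
      by (simp_all add: gf_add gf_single)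
    have s_eq: "cf p V s' = cf p U s"
      using SelD[OF f C(1), of "(- 1, s')" "(1, s)"] by (simp add: gfU gfV)
    define b where "b = cf p U (s + 1)"
    have mem: "(j, k mod int p) \<in> C2" if "j = 1 \<and> \<not> int p dvd k - s \<or> j = - 1 \<and> \<not> int p dvd k - s'" for j k
    proof -
      have "k mod int p \<noteq> s" if "\<not> int p dvd k - s"
        using that rng by (metis mod_eq_dvd_iff mod_pos_pos_trivial mod_mod_trivial)
      moreover have "k mod int p \<noteq> s'" if "\<not> int p dvd k - s'"
        using that rng by (metis mod_eq_dvd_iff mod_pos_pos_trivial mod_mod_trivial)
      ultimately show ?thesis using that p0 unfolding C2 lay_def by auto
    qed
    have ref: "(1, (s + 1) mod int p) \<in> C2" by (rule mem) (use p1 in simp)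
    have U: "cf p U k = (if int p dvd k - s then cf p U s - b else 0) + b" for k
    proof (cases "int p dvd k - s")
      case True
      then show ?thesis by (simp add: cf_index_cong[OF True])
    next
      case False
      then have "gf p (mon 1 U + mon (- 1) V) (1, k mod int p) = gf p (mon 1 U + mon (- 1) V) (1, (s + 1) mod int p)"
        by (intro SelD[OF f C(2) mem ref]) simp
      then show ?thesis using False by (simp only: gf_mod gfU b_def) simp
    qed
    have V: "cf p V k = (if int p dvd k - s' then cf p U s - b else 0) + b" for k
    proof (cases "int p dvd k - s'")
      case True
      then show ?thesis using s_eq by (simp add: cf_index_cong[OF True])
    next
      case False
      then have "gf p (mon 1 U + mon (- 1) V) (- 1, k mod int p) = gf p (mon 1 U + mon (- 1) V) (1, (s + 1) mod int p)"
        by (intro SelD[OF f C(2) mem ref]) simp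
      then show ?thesis using False by (simp only: gf_mod gfU gfV b_def) simp
    qed
    show ?thesis using U V by blast
  qed
  have gen: "\<exists>n b. \<forall>k. cf p U k = (if int p dvd k - s * j then n else 0) + b
        \<and> cf p V k = (if int p dvd k - s' * j then n else 0) + b"
    if f: "Sel (mon j U + mon (- j) V)" and j: "1 \<le> j" for U V j
  proof (cases "j = 1")
    case True
    then show ?thesis using one[of U V] f by simp
  next
    case False
    then have j2: "1 \<le> j - 1" using j by simp
    \<comment> \<open>The pair of powers with exponent \<open>j - 1\<close> leads back to the layers
      1 and -1. The part at j meets a power of w', not of the inverse of w; this is the source of
      the displacement \<open>r\<close> below.\<close>
    have "Sel (mon (j - (j - 1)) (U * Poly_Mapping.single (s' * (j - 1)) 1)
        + mon ((j - 1) - j) (V * Poly_Mapping.single (s * (j - 1)) 1))"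
      by (rule Sel_fold_prod_diff[OF L j j2 f W1[OF j2]])
    then have "Sel (mon 1 (Poly_Mapping.single (s' * (j - 1)) 1 * U) + mon (- 1) (Poly_Mapping.single (s * (j - 1)) 1 * V))"
      by (simp add: mult.commute)
    from one[OF this, unfolded cf_single_mult] obtain n b
      where nb: "\<And>k. cf p U (k - s' * (j - 1)) = (if int p dvd k - s then n else 0) + b"
        "\<And>k. cf p V (k - s * (j - 1)) = (if int p dvd k - s' then n else 0) + b"
      by auto
    define r where "r = (s + s') * (j - 1)"
    have U: "cf p U k = (if int p dvd (k - s * j) + r then n else 0) + b" for k
      using nb(1)[of "k + s' * (j - 1)"] by (simp add: r_def algebra_simps)
    have V: "cf p V k = (if int p dvd (k - s' * j) + r then n else 0) + b" for k
      using nb(2)[of "k + s * (j - 1)"] by (simp add: r_def algebra_simps)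
    show ?thesis
    proof (cases "int p dvd r")
      case True
      then have "int p dvd x + r \<longleftrightarrow> int p dvd x" for x by (simp add: dvd_add_left_iff)
      then show ?thesis using U V by auto
    next
      case False
      then have "p = 2" using c by (auto simp: r_def)
      \<comment> \<open>With only two residues, an odd displacement exchanges the distinguished
        point and its complement, and the result is again of the required form.\<close>
      then have "int p dvd x + r \<longleftrightarrow> \<not> int p dvd x" for x using False by simp
      then have "\<forall>k. cf p U k = (if int p dvd k - s * j then - n else 0) + (n + b)
        \<and> cf p V k = (if int p dvd k - s' * j then - n else 0) + (n + b)"
        using U V by auto
      then show ?thesis by blast
    qed
  qed
  show ?thesis
  proof
    assume gh: "same g h"
    have abs: "\<bar>fst g\<bar> = \<bar>fst h\<bar>" by (rule same_fst_fold[OF gh L])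
    define j where "j = \<bar>fst g\<bar>"
    have "\<delta> g \<longleftrightarrow> \<delta> h"
    proof (cases "j = 0")
      case True
      have "gf p 1 g = gf p 1 h" by (rule same_Sel[OF gh Sel_one])
      then show ?thesis using True abs by (simp add: gf_def lookup_one cf_one j_def \<delta>_def split: if_splits)
    next
      case False
      then have j1: "1 \<le> j" by (simp add: j_def)
      define f where "f = mon j (Poly_Mapping.single (s * j) 1) + mon (- j) (Poly_Mapping.single (s' * j) 1)"
      have f: "gf p f x = (if \<delta> x then 1 else 0)" if "\<bar>fst x\<bar> = j" for x
      proof (cases "0 \<le> fst x")
        case True
        then have "fst x = j" using that by simp
        then show ?thesis using j1
          by (cases x) (simp add: f_def gf_add gf_single cf_single \<delta>_def dvd_diff_commute)
      next
        case False
        then have "fst x = - j" using that by simp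
        then show ?thesis using j1
          by (cases x) (simp add: f_def gf_add gf_single cf_single \<delta>_def dvd_diff_commute)
      qed
      have "gf p f g = gf p f h" unfolding f_def by (rule same_Sel[OF gh W1[OF j1]])
      then show ?thesis using f[of g] f[of h] abs by (simp add: j_def split: if_splits)
    qed
    with abs show "\<bar>fst g\<bar> = \<bar>fst h\<bar> \<and> (\<delta> g \<longleftrightarrow> \<delta> h)" by simp
  next
    assume gh: "\<bar>fst g\<bar> = \<bar>fst h\<bar> \<and> (\<delta> g \<longleftrightarrow> \<delta> h)"
    define j where "j = \<bar>fst g\<bar>"
    show "same g h"
    proof (rule sameI[OF g h])
      fix D assume D: "D \<in> \<D>"
      show "gf p (bar D) g = gf p (bar D) h"
      proof (cases "j = 0")
        case True
        have "Sset (lay p {0})" using L[of 0] by simp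
        then have "Sel (mon 0 (Poly_Mapping.lookup (bar D) 0))" by (rule Sel_layer[OF Sel_bar_class[OF D]])
        then obtain n b where "\<And>i. cf p (Poly_Mapping.lookup (bar D) 0) i = (if int p dvd i then n else 0) + b"
          using triv unfolding triv0_def by blast
        moreover have "fst g = 0" "fst h = 0" "int p dvd snd g \<longleftrightarrow> int p dvd snd h"
          using True gh by (auto simp: j_def \<delta>_def)
        ultimately show ?thesis by (simp add: gf_def)
      next
        case False
        then have j1: "1 \<le> j" by (simp add: j_def)
        have "Sel (mon j (Poly_Mapping.lookup (bar D) j) + mon (- j) (Poly_Mapping.lookup (bar D) (- j)))"
          by (rule Sel_layer_fold[OF Sel_bar_class[OF D] L False])
        from gen[OF this j1] obtain n b where
          nb: "\<And>k. cf p (Poly_Mapping.lookup (bar D) j) k = (if int p dvd k - s * j then n else 0) + b"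
           "\<And>k. cf p (Poly_Mapping.lookup (bar D) (- j)) k = (if int p dvd k - s' * j then n else 0) + b"
          by blast
        have "gf p (bar D) x = (if \<delta> x then n else 0) + b" if "\<bar>fst x\<bar> = j" for x
        proof (cases "0 \<le> fst x")
          case True
          then have "fst x = j" using that by simp
          then show ?thesis using j1 by (simp add: gf_def nb \<delta>_def)
        next
          case False
          then have "fst x = - j" using that by simp
          then show ?thesis using j1 by (simp add: gf_def nb \<delta>_def)
        qed
        then show ?thesis using gh by (simp add: j_def)
      qed
    qed
  qed
qed


section \<open>Multipliers: the case where zA is a class\<close>

lemma coprime_int_p: "\<not> int p dvd x \<Longrightarrow> coprime x (int p)"
  using prime_imp_coprime[of "int p" x] p coprime_commute[of x "int p"] by simp

text \<open>Multiplying a class sum by the singleton class z^(-j) moves the coefficient at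
  \<open>(m + j, k)\<close> to \<open>(m, k)\<close>.\<close>

lemma same_translate:
  assumes j: "Sset {(- j, 0)}" and gh: "same (m, k) (m', k')" and rng: "(m + j, k) \<in> Gc p" "(m' + j, k') \<in> Gc p"
  shows "same (m + j, k) (m' + j, k')"
proof (rule sameI[OF rng])
  fix C assume C: "C \<in> \<D>"
  have "Sel (mon (- j) 1 * bar C)" by (intro Sel_mult Sel_single_class[OF j] Sel_bar_class[OF C])
  from same_Sel[OF gh this] show "gf p (bar C) (m + j, k) = gf p (bar C) (m' + j, k')"
    by (simp add: gf_def lookup_single_mult)
qed

lemma cf_sum_single_mult:
  assumes u: "coprime u p" and B: "B \<subseteq> {0..<int p}"
  shows "cf p (\<Sum>k\<in>B. Poly_Mapping.single (int u * k) 1) i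
    = (if i mod int p \<in> (\<lambda>k. int u * k mod int p) ` B then 1 else 0)"
proof -
  have fin: "finite B" using B finite_subset by blast
  have inj: "inj_on (\<lambda>k. int u * k mod int p) B"
  proof (rule inj_onI)
    fix x y assume xy: "x \<in> B" "y \<in> B" "int u * x mod int p = int u * y mod int p"
    then have "[int u * x = int u * y] (mod int p)" by (simp add: cong_def)
    then have "[x = y] (mod int p)" using u by (subst (asm) cong_mult_lcancel) simp_all
    then show "x = y" using xy(1,2) B by (auto simp: cong_def subset_iff)
  qed
  have "cf p (\<Sum>k\<in>B. Poly_Mapping.single (int u * k) 1) i
      = (\<Sum>k\<in>B. if int u * k mod int p = i mod int p then 1 else 0)"
    unfolding cf_sum by (intro sum.cong refl) (simp add: cf_single mod_eq_dvd_iff)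
  also have "\<dots> = (\<Sum>y\<in>(\<lambda>k. int u * k mod int p) ` B. if y = i mod int p then 1 else 0)"
    by (simp add: sum.reindex[OF inj])
  also have "\<dots> = (if i mod int p \<in> (\<lambda>k. int u * k mod int p) ` B then 1 else 0)"
    using fin by simp
  finally show ?thesis .
qed

text \<open>Schur's theorem on multipliers for a prime l: \<open>B ^ l\<close> is congruent modulo l
  to the image of B under a -> a^l. That image has coefficients 0 and 1, so it consists of the
  points where l does not divide the coefficient of \<open>B ^ l\<close>.\<close>

lemma Sset_prime_multiple:
  assumes L: "Sset (lay p {0})" and B: "Sset ({0} \<times> B)" "B \<subseteq> {0..<int p}" and l: "prime l" "coprime l p"
  shows "Sset ({0} \<times> (\<lambda>k. int l * k mod int p) ` B)"
proof -
  have fin: "finite B" using B finite_subset by blast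
  have f: "Sel (mon 0 (sm B ^ l))" using Sel_power[OF Sel_mon_sm[OF B], of l] by (simp add: single_power)
  have "of_nat l dvd sm B ^ l - (\<Sum>k\<in>B. Poly_Mapping.single k (1::int) ^ l)"
    unfolding sm_def by (rule of_nat_prime_dvd_freshman_sum[OF l(1) fin])
  then obtain V where V: "sm B ^ l - (\<Sum>k\<in>B. Poly_Mapping.single k (1::int) ^ l) = of_nat l * V"
    by (rule dvdE)
  let ?B = "(\<lambda>k. int l * k mod int p) ` B"
  have "cf p (sm B ^ l) i = (if i mod int p \<in> ?B then 1 else 0) + int l * cf p V i" for i
  proof -
    have "cf p (sm B ^ l) i = cf p (\<Sum>k\<in>B. Poly_Mapping.single k (1::int) ^ l) i + cf p (of_nat l * V) i"
      unfolding V[symmetric] cf_diff by simp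
    then show ?thesis
      by (simp only: single_power power_one cf_sum_single_mult[OF l(2) B(2)] cf_of_nat_mult)
  qed
  moreover have "int l dvd b + int l * c \<longleftrightarrow> int l dvd b" for b c
    by (rule dvd_add_left_iff) simp
  ultimately have cf: "int l dvd cf p (sm B ^ l) i \<longleftrightarrow> i mod int p \<notin> ?B" for i
    using prime_gt_1_nat[OF l(1)] by simp
  have "Sset ({x \<in> Gc p. \<not> int l dvd gf p (mon 0 (sm B ^ l)) x} \<inter> lay p {0})"
    by (intro Sset_Int Sset_level f L)
  also have "{x \<in> Gc p. \<not> int l dvd gf p (mon 0 (sm B ^ l)) x} \<inter> lay p {0} = {0} \<times> ?B"
    using p0 by (auto simp: Gc_def lay_def gf_single cf)
  finally show ?thesis .
qed

lemma Sset_multiple: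
  assumes L: "Sset (lay p {0})" and B: "Sset ({0} \<times> B)" "B \<subseteq> {0..<int p}" and "coprime u p"
  shows "Sset ({0} \<times> (\<lambda>k. int u * k mod int p) ` B)"
  using assms(4)
proof (induction u rule: less_induct)
  case (less u)
  show ?case
  proof (cases "u = 1")
    case True
    have "(\<lambda>k. int u * k mod int p) ` B = id ` B"
      using B(2) True by (intro image_cong) (auto simp: subset_iff)
    then show ?thesis using B by simp
  next
    case False
    then obtain l v where l: "prime l" "u = l * v" by (metis prime_factor_nat dvd_def)
    have cop: "coprime l p" "coprime v p" using less.prems l by auto
    \<comment> \<open>Coprimality to p excludes 0, so the cofactor v is smaller than u.\<close>
    have "v \<noteq> 0" using cop(2) p1 by (intro notI) simp
    then have "v < u" using l prime_gt_1_nat by simp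
    from less.IH[OF this cop(2)]
    have "Sset ({0} \<times> (\<lambda>k. int l * k mod int p) ` (\<lambda>k. int v * k mod int p) ` B)"
      by (rule Sset_prime_multiple[OF L _ _ l(1) cop(1)]) (use p0 in auto)
    also have "(\<lambda>k. int l * k mod int p) ` (\<lambda>k. int v * k mod int p) ` B = (\<lambda>k. int u * k mod int p) ` B"
      unfolding image_image l(2) by (intro image_cong refl) (simp add: mod_mult_right_eq mult.assoc)
    finally show ?thesis .
  qed
qed

text \<open>With w inverse to u modulo p, the multiple by w of the class of \<open>u * k\<close> is
  a union of classes containing k. So it contains k', and multiplying back by u gives the
  claim.\<close>

lemma same_multiple:
  assumes L: "Sset (lay p {0})" and same: "same (0, k) (0, k')" and u: "coprime u p"
  shows "same (0, int u * k mod int p) (0, int u * k' mod int p)"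
proof -
  have rng: "k \<in> {0..<int p}" "k' \<in> {0..<int p}" using same_Gc[OF same] by (auto simp: Gc_def)
  from u obtain v where v: "[int u * v = 1] (mod int p)"
    using cong_solve_coprime_int[of "int u" "int p"] by auto
  define w where "w = nat (v mod int p)"
  have "int w = v mod int p" using p0 by (simp add: w_def)
  then have w: "[int u * int w = 1] (mod int p)"
    using v by (simp add: cong_def mod_mult_right_eq)
  have uv: "int u * (int w * x) mod int p = x mod int p" for x
    using cong_scalar_right[OF w, of x] by (simp add: cong_def mult.assoc)
  have cop_v: "coprime w p"
  proof -
    have "\<not> int p dvd int w"
    proof
      assume "int p dvd int w"
      then have "int p dvd int u * int w" by (rule dvd_mult)
      then show False using cong_dvd_iff[OF w] p1 by simp
    qed
    from coprime_int_p[OF this] show ?thesis by simp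
  qed
  have "(0, int u * k mod int p) \<in> Gc p" using p0 by (simp add: Gc_def)
  then obtain C where C: "C \<in> \<D>" "(0, int u * k mod int p) \<in> C" by (rule class_of)
  define B where "B = {k. (0, k) \<in> C}"
  have "C \<subseteq> lay p {0}" using SsetD[OF L C] sub[OF C(1)] p0 by (auto simp: lay_def)
  then have CB: "C = {0} \<times> B" by (auto simp: B_def lay_def)
  have B: "B \<subseteq> {0..<int p}" using \<open>C \<subseteq> lay p {0}\<close> by (auto simp: B_def lay_def)
  have "Sset ({0} \<times> (\<lambda>k. int w * k mod int p) ` B)"
    using Sset_multiple[OF L _ B cop_v] Sset_class[OF C(1)] CB by simp
  moreover have "(0, k) \<in> {0} \<times> (\<lambda>k. int w * k mod int p) ` B"
  proof -
    have "int w * (int u * k mod int p) mod int p = k"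
      using uv[of k] rng by (simp add: mod_mult_right_eq mult.left_commute)
    moreover have "int u * k mod int p \<in> B" using C(2) by (simp add: B_def)
    ultimately show ?thesis by force
  qed
  ultimately have "(0, k') \<in> {0} \<times> (\<lambda>k. int w * k mod int p) ` B" using same_Sset[OF same] by blast
  then obtain x where x: "x \<in> B" "k' = int w * x mod int p" by blast
  then have "int u * k' mod int p = x"
    using uv[of x] B by (auto simp: mod_mult_right_eq)
  then have "(0, int u * k' mod int p) \<in> C" using x by (simp add: CB)
  then show ?thesis using C unfolding same_def by blast
qed

text \<open>If a class were a proper part B of the layer m, its power B^N with
  \<open>m * N = 1\<close> modulo p could be shifted to the layer 1, where all coefficients agree.
  Cancelling B repeatedly would make the coefficients of the identity of Z_p constant.\<close>

lemma same_coprime_layer: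
  assumes L: "\<And>j. Sset (lay p {j})" and C1: "lay p {1} \<in> \<D>" and K: "Sset {(int p * m, 0) | m. True}"
    and m: "\<not> int p dvd m" and g: "g \<in> lay p {m}" and h: "h \<in> lay p {m}"
  shows "same g h"
proof -
  obtain C where C: "C \<in> \<D>" "g \<in> C" using g lay_subset class_of by blast
  define B where "B = {k. (m, k) \<in> C}"
  have sub: "C \<subseteq> lay p {m}" using SsetD[OF L C g] by blast
  then have CB: "C = {m} \<times> B" by (auto simp: B_def lay_def)
  have B: "B \<subseteq> {0..<int p}" using sub by (auto simp: B_def lay_def)
  have finB: "finite B" using B finite_subset by blast
  have "B = {0..<int p}"
  proof (rule ccontr)
    assume "B \<noteq> {0..<int p}"
    then have "card B < card {0..<int p}" using B by (intro psubset_card_mono) auto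
    moreover have "0 < card B" using C(2) CB finB by (auto simp: card_gt_0_iff)
    ultimately have ndvd: "\<not> p dvd card B" by (simp add: nat_dvd_not_less)
    have "coprime m (int p)" by (rule coprime_int_p[OF m])
    then obtain x where x: "[m * x = 1] (mod int p)" using cong_solve_coprime_int by blast
    define N where "N = nat (x mod int p)"
    have "int N = x mod int p" using p0 by (simp add: N_def)
    then have "(m * int N) mod int p = 1 mod int p" using x by (simp add: cong_def mod_mult_right_eq)
    then have "int p dvd m * int N - 1" by (simp only: mod_eq_dvd_iff)
    then have "int p dvd 1 - m * int N" by (subst dvd_diff_commute)
    then obtain m' where m': "1 - m * int N = int p * m'" by (rule dvdE)
    have "Sel (mon m (sm B))" using Sel_mon_sm[OF _ B] Sset_class[OF C(1)] CB by simp
    from Sel_power[OF this, of N] have "Sel (mon (m * int N) (sm B ^ N))"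
      by (simp add: single_power mult.commute)
    from Sel_mult[OF this Sel_single_class[OF Sset_p_power[OF K L, of m']]]
    have f: "Sel (mon 1 (sm B ^ N))" by (simp add: mult_single flip: m')
    have "cf p (sm B ^ N) i = cf p (sm B ^ N) 0" for i
    proof -
      have "gf p (mon 1 (sm B ^ N)) (1, i mod int p) = gf p (mon 1 (sm B ^ N)) (1, 0)"
        using p0 by (intro SelD[OF f C1]) (auto simp: lay_def)
      then show ?thesis by (simp add: gf_single)
    qed
    then have "cconst p 0 (sm B ^ N)" unfolding cconst_def by (metis diff_self dvd_0_right)
    moreover have "cconst p 0 (sm B ^ n) \<Longrightarrow> cconst p 0 1" for n
      by (induction n) (auto dest: cconst_cancel_sm[OF p finB ndvd])
    ultimately have "cconst p 0 1" by blast
    then have "cf p 1 0 = cf p 1 1" by (simp add: cconst_def)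
    then show False using p1 by (simp add: cf_one)
  qed
  then have "C = lay p {m}" using CB by (auto simp: lay_def)
  then show ?thesis using C h unfolding same_def by blast
qed

text \<open>Schur's theorem on multipliers makes the class of a in Z_p a subgroup of (Z/p)*; \<open>mults\<close> consists of
  the integers representing it.\<close>

definition mults :: "int set" where
  "mults = {t. \<not> int p dvd t \<and> (\<forall>k. same (0, k mod int p) (0, t * k mod int p))}"

lemma mults_1: "1 \<in> mults"
proof -
  have "same (0, k mod int p) (0, k mod int p)" for k
    by (rule same_refl) (use p0 in \<open>simp add: Gc_def\<close>)
  then show ?thesis using p1 by (simp add: mults_def)
qed

lemma mults_mult:
  assumes "t \<in> mults" "t' \<in> mults" shows "t * t' \<in> mults"
proof -
  have "same (0, k mod int p) (0, t * t' * k mod int p)" for k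
  proof -
    have "same (0, k mod int p) (0, t' * k mod int p)" "same (0, t' * k mod int p) (0, t * (t' * k) mod int p)"
      using assms by (auto simp: mults_def)
    then show ?thesis using same_trans by (simp add: mult.assoc)
  qed
  then show ?thesis using assms p by (simp add: mults_def prime_dvd_mult_iff)
qed

lemma same_sym: "same g h \<Longrightarrow> same h g"
  unfolding same_def by blast

lemma mults_inverse:
  assumes "t \<in> mults" "[t * t' = 1] (mod int p)" shows "t' \<in> mults"
proof -
  have "same (0, k mod int p) (0, t' * k mod int p)" for k
  proof -
    have "same (0, t' * k mod int p) (0, t * (t' * k) mod int p)" using assms by (auto simp: mults_def)
    moreover have "t * (t' * k) mod int p = k mod int p"
      using cong_scalar_right[OF assms(2), of k] by (simp add: cong_def mult.assoc)
    ultimately show ?thesis using same_sym by simp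
  qed
  moreover have "\<not> int p dvd t'"
  proof
    assume "int p dvd t'"
    then have "int p dvd t * t'" by simp
    then have "int p dvd 1" using cong_dvd_iff[OF assms(2)] by simp
    then show False using p1 by simp
  qed
  ultimately show ?thesis by (simp add: mults_def)
qed

text \<open>Layers prime to p are single classes; the others are translates of the layer 0 by
  singleton classes. There the ratio \<open>k2 / k\<close> of two nonzero elements of one class is a
  multiplier.\<close>

lemma same_coset_layer:
  assumes C1: "lay p {1} \<in> \<D>" and K: "Sset {(int p * m, 0) | m. True}"
    and g: "g \<in> Gc p" and h: "h \<in> Gc p"
  shows "same g h \<longleftrightarrow> fst g = fst h \<and> (int p dvd fst g \<longrightarrow> (\<exists>t\<in>mults. snd h = t * snd g mod int p))"
proof -
  have L: "Sset (lay p {j})" for j by (rule Sset_lay_all[OF Sset_class[OF C1]])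
  obtain m k where g': "g = (m, k)" by (cases g)
  obtain m2 k2 where h': "h = (m2, k2)" by (cases h)
  have k: "0 \<le> k" "k < int p" and k2: "0 \<le> k2" "k2 < int p" using g h by (auto simp: Gc_def g' h')
  show ?thesis
  proof
    assume gh: "same g h"
    have fst: "fst g = fst h" by (rule same_fst[OF gh L])
    have "\<exists>t\<in>mults. k2 = t * k mod int p" if dm: "int p dvd m"
    proof -
      obtain m' where m': "m = int p * m'" using dm by (rule dvdE)
      have "Sset {(- (- m), 0)}" using Sset_p_power[OF K L, of m'] by (simp add: m')
      then have "same (m + (- m), k) (m2 + (- m), k2)"
        by (rule same_translate) (use gh fst k k2 in \<open>auto simp: g' h' Gc_def\<close>)
      then have s0: "same (0, k) (0, k2)" using fst by (simp add: g' h')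
      show ?thesis
      proof (cases "k = 0")
        case True
        then have "k2 = 0" using same_Sset[OF s0 Sset_class[OF unit]] by (simp add: gone_def)
        then show ?thesis using True mults_1 by (intro bexI[of _ 1]) auto
      next
        case False
        then have nk: "\<not> int p dvd k" using k by (auto dest: zdvd_imp_le)
        have "k2 \<noteq> 0"
        proof
          assume "k2 = 0"
          then have "k = 0" using same_Sset[OF s0 Sset_class[OF unit]] by (simp add: gone_def)
          then show False using False by simp
        qed
        then have nk2: "\<not> int p dvd k2" using k2 by (auto dest: zdvd_imp_le)
        have "coprime k (int p)" by (rule coprime_int_p[OF nk])
        then obtain x where x: "[k * x = 1] (mod int p)" using cong_solve_coprime_int by blast
        have nx: "\<not> int p dvd x"
        proof
          assume "int p dvd x"
          then have "int p dvd k * x" by simp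
          then have "int p dvd 1" using cong_dvd_iff[OF x] by simp
          then show False using p1 by simp
        qed
        have tk: "k2 * x * y * k mod int p = k2 * y mod int p" for y
          using cong_scalar_right[OF x, of "k2 * y"] by (simp add: cong_def algebra_simps)
        have "same (0, y mod int p) (0, k2 * x * y mod int p)" for y
        proof (cases "int p dvd y")
          case True
          then have "y mod int p = 0" "k2 * x * y mod int p = 0" by auto
          then show ?thesis using same_refl[of "(0, 0)"] p0 by (simp add: Gc_def)
        next
          case False
          \<comment> \<open>As x is the inverse of k, u is \<open>y / k\<close>; it sends k to y and
            k2 to \<open>k2 * x * y\<close>.\<close>
          define u where "u = nat (x * y mod int p)"
          have u: "int u = x * y mod int p" using p0 by (simp add: u_def)
          have "\<not> int p dvd x * y" using False nx p by (simp add: prime_dvd_mult_iff)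
          then have "\<not> int p dvd int u" by (simp add: u dvd_mod_iff)
          from coprime_int_p[OF this] have "coprime u p" by simp
          from same_multiple[OF L s0 this]
          have "same (0, x * y * k mod int p) (0, x * y * k2 mod int p)"
            unfolding u mod_mult_left_eq .
          moreover have "x * y * k mod int p = y mod int p"
            using cong_scalar_right[OF x, of y] by (simp add: cong_def algebra_simps)
          ultimately show ?thesis by (simp add: algebra_simps)
        qed
        then have "k2 * x \<in> mults" using nk2 nx p by (simp add: mults_def prime_dvd_mult_iff)
        moreover have "k2 = k2 * x * k mod int p" using tk[of 1] k2 by simp
        ultimately show ?thesis by blast
      qed
    qed
    then show "fst g = fst h \<and> (int p dvd fst g \<longrightarrow> (\<exists>t\<in>mults. snd h = t * snd g mod int p))"
      using fst by (simp add: g' h')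
  next
    assume gh: "fst g = fst h \<and> (int p dvd fst g \<longrightarrow> (\<exists>t\<in>mults. snd h = t * snd g mod int p))"
    then have m2: "m2 = m" by (simp add: g' h')
    show "same g h"
    proof (cases "int p dvd m")
      case True
      then obtain t where t: "t \<in> mults" "k2 = t * k mod int p" using gh by (auto simp: g' h')
      have "same (0, k mod int p) (0, t * k mod int p)" using t by (simp add: mults_def)
      then have "same (0, k) (0, k2)" using t k by simp
      obtain m' where m': "m = int p * m'" using True by (rule dvdE)
      have "Sset {(- m, 0)}" using Sset_p_power[OF K L, of "- m'"] by (simp add: m')
      then have "same (0 + m, k) (0 + m, k2)"
        by (rule same_translate[OF _ \<open>same (0, k) (0, k2)\<close>]) (use g h m2 in \<open>auto simp: g' h' Gc_def\<close>)
      then show ?thesis by (simp add: g' h' m2)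
    next
      case False
      have "g \<in> lay p {m}" "h \<in> lay p {m}" using k k2 by (auto simp: lay_def g' h' m2)
      then show ?thesis by (rule same_coprime_layer[OF L C1 K False])
    qed
  qed
qed

end

section \<open>Automorphisms of Z x Z_p\<close>

text \<open>Outside \<open>Gc p\<close> it is the identity, as \<open>aut\<close> demands, so that
  composition and inversion are equations between total functions.\<close>

definition au :: "nat \<Rightarrow> int \<Rightarrow> int \<Rightarrow> int \<Rightarrow> int \<times> int \<Rightarrow> int \<times> int" where
  "au p e s t x = (if x \<in> Gc p then (e * fst x, (s * fst x + t * snd x) mod int p) else x)"

lemma au_Gc: "0 < p \<Longrightarrow> x \<in> Gc p \<Longrightarrow> au p e s t x \<in> Gc p"
  by (simp add: au_def Gc_def)

lemma mod_add_mult_mod: "(a + t * (b mod n)) mod n = (a + t * b) mod (n::int)"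
  by (metis mod_add_right_eq mod_mult_right_eq)

lemma au_comp:
  assumes "0 < p"
  shows "au p e s t \<circ> au p e' s' t' = au p (e * e') (s * e' + t * s') (t * t')"
proof
  fix x
  show "(au p e s t \<circ> au p e' s' t') x = au p (e * e') (s * e' + t * s') (t * t') x"
  proof (cases "x \<in> Gc p")
    case True
    then have "au p e' s' t' x \<in> Gc p" using assms by (simp add: au_Gc)
    moreover have "(s * (e' * fst x) + t * ((s' * fst x + t' * snd x) mod int p)) mod int p
        = ((s * e' + t * s') * fst x + t * t' * snd x) mod int p"
      unfolding mod_add_mult_mod by (simp add: algebra_simps)
    ultimately show ?thesis using True by (simp add: au_def)
  qed (simp add: au_def)
qed

lemma au_cong:
  assumes "int p dvd s - s'" "int p dvd t - t'" shows "au p e s t = au p e s' t'"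
proof
  fix x
  have "int p dvd (s - s') * fst x + (t - t') * snd x" using assms by simp
  then have "int p dvd (s * fst x + t * snd x) - (s' * fst x + t' * snd x)" by (simp add: algebra_simps)
  then show "au p e s t x = au p e s' t' x" by (simp add: au_def mod_eq_dvd_iff)
qed

lemma au_id: "au p 1 0 1 = id"
  by (rule ext) (auto simp: au_def Gc_def)

text \<open>By the composition law the middle parameter s'' of the inverse solves
  \<open>s'' * e + t' * s = 0\<close>, and \<open>e\<close> is its own inverse.\<close>

lemma au_inverse:
  assumes "0 < p" and e: "e = 1 \<or> e = - 1" and t: "[t * t' = 1] (mod int p)"
  shows "au p e (- (e * t' * s)) t' \<circ> au p e s t = id"
    and "au p e s t \<circ> au p e (- (e * t' * s)) t' = id"
proof -
  have ee: "e * e = 1" using e by auto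
  have d: "int p dvd t * t' - 1" using t by (simp add: cong_iff_dvd_diff)
  have 1: "- (e * t' * s) * e + t' * s = 0" using e by auto
  have 2: "int p dvd (s * e + t * - (e * t' * s)) - 0"
  proof -
    have "s * e + t * - (e * t' * s) - 0 = - (s * e) * (t * t' - 1)" by (simp add: algebra_simps)
    then show ?thesis using d by (metis dvd_mult)
  qed
  show "au p e (- (e * t' * s)) t' \<circ> au p e s t = id"
    unfolding au_comp[OF assms(1)] ee 1
    using au_cong[of p 0 0 "t' * t" 1 1] d by (simp add: au_id mult.commute)
  show "au p e s t \<circ> au p e (- (e * t' * s)) t' = id"
    unfolding au_comp[OF assms(1)] ee using au_cong[OF 2 d, of 1] by (simp add: au_id)
qed

lemma au_aut:
  assumes p: "0 < p" and e: "e = 1 \<or> e = - 1" and t: "[t * t' = 1] (mod int p)"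
  shows "au p e s t \<in> aut p"
proof -
  have "bij_betw (au p e s t) (Gc p) (Gc p)"
  proof (rule bij_betw_byWitness[where f' = "au p e (- (e * t' * s)) t'"])
    show "\<forall>a\<in>Gc p. au p e (- (e * t' * s)) t' (au p e s t a) = a"
      using au_inverse(1)[OF p e t] by (metis comp_apply id_apply)
    show "\<forall>a\<in>Gc p. au p e s t (au p e (- (e * t' * s)) t' a) = a"
      using au_inverse(2)[OF p e t] by (metis comp_apply id_apply)
  qed (use p au_Gc in auto)
  moreover have "au p e s t (gmul p g h) = gmul p (au p e s t g) (au p e s t h)"
    if "g \<in> Gc p" "h \<in> Gc p" for g h
  proof -
    have "gmul p g h \<in> Gc p" using p by (simp add: gmul_def Gc_def)
    then show ?thesis using that
      by (simp add: au_def gmul_def mod_add_mult_mod mod_add_eq) (simp add: algebra_simps)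
  qed
  ultimately show ?thesis by (simp add: aut_def au_def)
qed

section \<open>Orbits and the fixed algebra\<close>

context schur_partition
begin

text \<open>The counterpart of \<open>Sel\<close> over the field, in a form that can be compared
  with \<open>fixed_alg\<close>.\<close>

lemma span_cls_iff:
  fixes f :: "int \<times> int \<Rightarrow> 'f::field_char_0"
  shows "f \<in> span_cls \<D> \<longleftrightarrow> f \<in> group_alg p \<and> (\<forall>g h. same g h \<longrightarrow> f g = f h)"
proof
  assume "f \<in> span_cls \<D>"
  then obtain T c where T: "finite T" "T \<subseteq> \<D>" "f = (\<lambda>x. \<Sum>C\<in>T. c C * cls_sum C x)"
    unfolding span_cls_def by blast
  have supp: "{g. f g \<noteq> 0} \<subseteq> \<Union>T"
  proof
    fix g assume "g \<in> {g. f g \<noteq> 0}"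
    then have "(\<Sum>C\<in>T. c C * cls_sum C g) \<noteq> 0" by (simp add: T(3))
    then obtain C where "C \<in> T" "c C * cls_sum C g \<noteq> 0" by (rule sum.not_neutral_contains_not_neutral)
    then show "g \<in> \<Union>T" by (auto simp: cls_sum_def split: if_splits)
  qed
  have "finite (\<Union>T)" using T(1,2) fin by blast
  then have "finite {g. f g \<noteq> 0}" using supp finite_subset by blast
  moreover have "{g. f g \<noteq> 0} \<subseteq> Gc p" using supp T(2) cover by blast
  moreover have "f g = f h" if gh: "same g h" for g h
  proof -
    have "g \<in> C \<longleftrightarrow> h \<in> C" if "C \<in> T" for C
      using same_Sset[OF gh Sset_class] that T(2) by blast
    then show ?thesis unfolding T(3) by (intro sum.cong refl) (simp add: cls_sum_def)
  qed
  ultimately show "f \<in> group_alg p \<and> (\<forall>g h. same g h \<longrightarrow> f g = f h)" by (auto simp: group_alg_def)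
next
  assume f: "f \<in> group_alg p \<and> (\<forall>g h. same g h \<longrightarrow> f g = f h)"
  define T where "T = {C \<in> \<D>. \<exists>x\<in>C. f x \<noteq> 0}"
  define c where "c C = f (SOME x. x \<in> C)" for C
  have "T \<subseteq> (\<lambda>x. THE C. C \<in> \<D> \<and> x \<in> C) ` {x. f x \<noteq> 0}"
  proof
    fix C assume "C \<in> T"
    then obtain x where x: "C \<in> \<D>" "x \<in> C" "f x \<noteq> 0" by (auto simp: T_def)
    have "(THE C. C \<in> \<D> \<and> x \<in> C) = C"
    proof (rule the_equality)
      show "E = C" if "E \<in> \<D> \<and> x \<in> E" for E
        using that x disj[of E C x] by simp
    qed (use x in simp)
    then show "C \<in> (\<lambda>x. THE C. C \<in> \<D> \<and> x \<in> C) ` {x. f x \<noteq> 0}"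
      using x by (intro image_eqI[of _ _ x]) auto
  qed
  then have finT: "finite T" using f finite_surj by (auto simp: group_alg_def)
  have "f x = (\<Sum>C\<in>T. c C * cls_sum C x)" for x
  proof (cases "x \<in> Gc p")
    case True
    then obtain E where E: "E \<in> \<D>" "x \<in> E" by (rule class_of)
    have "(SOME y. y \<in> E) \<in> E" using E(2) by (rule someI)
    then have "same (SOME y. y \<in> E) x" using E unfolding same_def by blast
    then have cE: "c E = f x" unfolding c_def using f by blast
    have "(\<Sum>C\<in>T. c C * cls_sum C x) = (\<Sum>C\<in>T. if C = E then c C else 0)"
    proof (intro sum.cong refl)
      fix C assume "C \<in> T"
      then have C: "C \<in> \<D>" by (simp add: T_def)
      then have "x \<in> C \<longleftrightarrow> C = E" using E disj[OF C E(1) _ E(2)] by auto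
      then show "c C * cls_sum C x = (if C = E then c C else 0)" by (simp add: cls_sum_def)
    qed
    also have "\<dots> = f x" using finT cE E by (auto simp: T_def)
    finally show ?thesis by simp
  next
    case False
    then have "f x = 0" using f by (auto simp: group_alg_def)
    moreover have "cls_sum C x = (0 :: 'f)" if "C \<in> T" for C
      using that False sub[of C] by (auto simp: T_def cls_sum_def)
    ultimately show ?thesis by simp
  qed
  then have "f = (\<lambda>x. \<Sum>C\<in>T. c C * cls_sum C x)" by blast
  moreover have "T \<subseteq> \<D>" by (auto simp: T_def)
  ultimately show "f \<in> span_cls \<D>" unfolding span_cls_def using finT by blast
qed

text \<open>\<open>Q\<close> describes the group by integer parameters, with closure conditions read
  off from the composition law of \<open>au\<close>. The group is finite because e is a sign and s
  and t matter only modulo p.\<close>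

lemma automorphic_if_orbits:
  assumes Q: "\<And>e s t. Q e s t \<Longrightarrow> (e = 1 \<or> e = - 1) \<and> \<not> int p dvd t"
    and Q_id: "Q 1 0 1"
    and Q_comp: "\<And>e s t e' s' t'. Q e s t \<Longrightarrow> Q e' s' t' \<Longrightarrow> Q (e * e') (s * e' + t * s') (t * t')"
    and Q_inv: "\<And>e s t t'. Q e s t \<Longrightarrow> [t * t' = 1] (mod int p) \<Longrightarrow> Q e (- (e * t' * s)) t'"
    and orbit: "\<And>g h. g \<in> Gc p \<Longrightarrow> h \<in> Gc p \<Longrightarrow> same g h \<longleftrightarrow> (\<exists>e s t. Q e s t \<and> au p e s t g = h)"
  shows "automorphic p (span_cls \<D> :: (int \<times> int \<Rightarrow> 'f::field_char_0) set)"
proof -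
  define H where "H = {au p e s t | e s t. Q e s t}"
  have inv_t: "\<exists>t'. [t * t' = 1] (mod int p)" if "Q e s t" for e s t
    using coprime_int_p[of t] Q[OF that] cong_solve_coprime_int by blast
  have "H \<subseteq> (\<lambda>(e, s, t). au p e s t) ` ({1, - 1} \<times> {0..<int p} \<times> {0..<int p})"
  proof
    fix \<sigma> assume "\<sigma> \<in> H"
    then obtain e s t where est: "Q e s t" "\<sigma> = au p e s t" by (auto simp: H_def)
    have "\<sigma> = au p e (s mod int p) (t mod int p)"
      unfolding est(2) by (rule au_cong) (simp_all flip: mod_eq_dvd_iff)
    then show "\<sigma> \<in> (\<lambda>(e, s, t). au p e s t) ` ({1, - 1} \<times> {0..<int p} \<times> {0..<int p})"
      using Q[OF est(1)] p0 by (intro image_eqI[of _ _ "(e, s mod int p, t mod int p)"]) auto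
  qed
  then have "finite H" by (rule finite_subset) simp
  moreover have "aut_subgroup p H"
    unfolding aut_subgroup_def
  proof (intro conjI ballI subsetI)
    fix \<sigma> assume "\<sigma> \<in> H"
    then obtain e s t where est: "Q e s t" "\<sigma> = au p e s t" by (auto simp: H_def)
    obtain t' where t': "[t * t' = 1] (mod int p)" using inv_t[OF est(1)] by blast
    show "\<sigma> \<in> aut p" unfolding est(2) using Q[OF est(1)] by (intro au_aut[OF p0 _ t']) simp
    have "au p e (- (e * t' * s)) t' \<in> H" using Q_inv[OF est(1) t'] by (auto simp: H_def)
    moreover have "au p e (- (e * t' * s)) t' \<circ> \<sigma> = id"
      unfolding est(2) using Q[OF est(1)] by (intro au_inverse(1)[OF p0 _ t']) simp
    ultimately show "\<exists>\<tau>\<in>H. \<tau> \<circ> \<sigma> = id" by blast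
  next
    show "id \<in> H" using Q_id au_id[of p] unfolding H_def by force
  next
    fix \<sigma> \<tau> assume "\<sigma> \<in> H" "\<tau> \<in> H"
    then obtain e s t e' s' t' where "Q e s t" "\<sigma> = au p e s t" "Q e' s' t'" "\<tau> = au p e' s' t'"
      by (auto simp: H_def)
    then show "\<sigma> \<circ> \<tau> \<in> H" using Q_comp au_comp[OF p0] unfolding H_def by blast
  qed
  moreover have "span_cls \<D> = (fixed_alg p H :: (int \<times> int \<Rightarrow> 'f) set)"
  proof -
    have "(\<forall>g h. same g h \<longrightarrow> f g = f h) \<longleftrightarrow> (\<forall>\<sigma>\<in>H. \<forall>g\<in>Gc p. f (\<sigma> g) = f g)" for f :: "int \<times> int \<Rightarrow> 'f"
    proof
      assume f: "\<forall>g h. same g h \<longrightarrow> f g = f h"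
      show "\<forall>\<sigma>\<in>H. \<forall>g\<in>Gc p. f (\<sigma> g) = f g"
      proof (intro ballI)
        fix \<sigma> g assume "\<sigma> \<in> H" and g: "g \<in> Gc p"
        then obtain e s t where est: "Q e s t" "\<sigma> = au p e s t" by (auto simp: H_def)
        have "same g (\<sigma> g)" using orbit[OF g au_Gc[OF p0 g]] est by blast
        then have "f g = f (\<sigma> g)" using f by blast
        then show "f (\<sigma> g) = f g" ..
      qed
    next
      assume f: "\<forall>\<sigma>\<in>H. \<forall>g\<in>Gc p. f (\<sigma> g) = f g"
      show "\<forall>g h. same g h \<longrightarrow> f g = f h"
      proof (intro allI impI)
        fix g h assume gh: "same g h"
        then obtain e s t where est: "Q e s t" "au p e s t g = h" using orbit same_Gc by blast
        then have "au p e s t \<in> H" by (auto simp: H_def)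
        then have "f (au p e s t g) = f g" using f same_Gc(1)[OF gh] by blast
        then show "f g = f h" using est by simp
      qed
    qed
    then show ?thesis by (auto simp: span_cls_iff fixed_alg_def)
  qed
  ultimately show ?thesis unfolding automorphic_def by blast
qed

text \<open>Either both numbers vanish modulo p and \<open>t = 1\<close> will do, or both are units
  and t is their quotient.\<close>

lemma exists_unit_multiplier:
  assumes "int p dvd d \<longleftrightarrow> int p dvd d'"
  obtains t where "\<not> int p dvd t" "int p dvd d' - t * d"
proof (cases "int p dvd d")
  case True
  then have "int p dvd d' - 1 * d" using assms by simp
  then show ?thesis using that[of 1] p1 by simp
next
  case False
  obtain x where x: "[d * x = 1] (mod int p)" using coprime_int_p[OF False] cong_solve_coprime_int by blast
  have "\<not> int p dvd x"
  proof
    assume "int p dvd x"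
    then have "int p dvd d * x" by simp
    then show False using cong_dvd_iff[OF x] p1 by simp
  qed
  then have "\<not> int p dvd d' * x" using False assms p by (simp add: prime_dvd_mult_iff)
  moreover have "int p dvd d * x - 1" using x by (simp add: cong_iff_dvd_diff)
  then have "int p dvd - d' * (d * x - 1)" by (rule dvd_mult)
  then have "int p dvd d' - (d' * x) * d" by (simp add: algebra_simps)
  ultimately show ?thesis by (rule that)
qed

text \<open>With w = (1, s) and w' = (-1, s'), the group consists of the maps w \<mapsto> w or w', a \<mapsto> a^t. As w w' = a^(s + s')
  has to be fixed, either s + s' = 0 or p = 2, and then t = 1.\<close>

lemma automorphic_linear:
  fixes s s' :: int
  defines "base \<equiv> \<lambda>m. if 0 \<le> m then s * m else - s' * m"
  assumes E: "E = {1} \<or> E = {1, - 1 :: int}" and c: "int p dvd s + s' \<or> p = 2"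
    and same: "\<And>g h. g \<in> Gc p \<Longrightarrow> h \<in> Gc p \<Longrightarrow> same g h \<longleftrightarrow> (\<exists>e\<in>E. fst h = e * fst g) \<and>
      (int p dvd snd g - base (fst g) \<longleftrightarrow> int p dvd snd h - base (fst h))"
  shows "automorphic p (span_cls \<D> :: (int \<times> int \<Rightarrow> 'f::field_char_0) set)"
proof -
  \<comment> \<open>\<open>r e t\<close> is the middle parameter for which the map with data e and t
    sends w to w if \<open>e = 1\<close>, and to w' if \<open>e = - 1\<close>.\<close>
  define r where "r e t = (if e = 1 then s * (1 - t) else s' - t * s)" for e t :: int
  define Q where "Q e x t \<longleftrightarrow> e \<in> E \<and> \<not> int p dvd t \<and> int p dvd x - r e t" for e x t
  \<comment> \<open>If \<open>p = 2\<close>, a unit t is odd, so that \<open>t - 1\<close> is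
    even.\<close>
  have key: "int p dvd (t - 1) * (s + s')" if "\<not> int p dvd t" for t
    using c that by auto
  have E1: "1 \<in> E" and Ee: "e = 1 \<or> e = - 1" if "e \<in> E" for e using E that by auto
  have Emult: "e * e' \<in> E" if "e \<in> E" "e' \<in> E" for e e' using E that by auto
  have r_comp: "int p dvd r e t * e' + t * r e' t' - r (e * e') (t * t')"
    if "e \<in> E" "e' \<in> E" "\<not> int p dvd t" for e e' t t'
  proof -
    have "r e t * e' + t * r e' t' - r (e * e') (t * t') = 0 \<or>
        r e t * e' + t * r e' t' - r (e * e') (t * t') = (t - 1) * (s + s')"
      using Ee[OF that(1)] Ee[OF that(2)] by (auto simp: r_def algebra_simps)
    then show ?thesis using key[OF that(3)] by auto
  qed
  have r_inv: "int p dvd - (e * t' * r e t) - r e t'"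
    if "e \<in> E" "\<not> int p dvd t'" "int p dvd t * t' - 1" for e t t'
  proof -
    have "- (e * t' * r e t) - r e t' = s * (t * t' - 1) \<or>
        - (e * t' * r e t) - r e t' = (t' - 1) * (s + s') + - s * (t * t' - 1)"
      using Ee[OF that(1)] by (auto simp: r_def algebra_simps)
    moreover have "int p dvd s * (t * t' - 1)" "int p dvd (t' - 1) * (s + s') + - s * (t * t' - 1)"
      using that(3) key[OF that(2)] by (auto intro: dvd_mult dvd_add)
    ultimately show ?thesis by metis
  qed
  have r_base: "int p dvd r e t * m + t * k - base (e * m) - t * (k - base m)"
    if "e \<in> E" "\<not> int p dvd t" for e t m k
  proof -
    have "r e t * m + t * k - base (e * m) - t * (k - base m) = 0 \<or>
        r e t * m + t * k - base (e * m) - t * (k - base m) = - m * ((t - 1) * (s + s'))"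
      using Ee[OF that(1)] by (auto simp: r_def base_def algebra_simps)
    moreover have "int p dvd - m * ((t - 1) * (s + s'))" using key[OF that(2)] by (rule dvd_mult)
    ultimately show ?thesis by (metis dvd_0_right)
  qed
  \<comment> \<open>Modulo p the map multiplies by t the displacement \<open>k - base m\<close> from
    the distinguished point of the layer.\<close>
  have action: "int p dvd (x * m + t * k) mod int p - base (e * m) - t * (k - base m)"
    if "Q e x t" for e x t m k
  proof -
    have Q: "e \<in> E" "\<not> int p dvd t" "int p dvd x - r e t" using that by (auto simp: Q_def)
    have 1: "int p dvd (x * m + t * k) mod int p - (x * m + t * k)" by (simp flip: mod_eq_dvd_iff)
    have 2: "int p dvd (x - r e t) * m" using Q(3) by simp
    have eq: "(x * m + t * k) mod int p - base (e * m) - t * (k - base m)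
      = ((x * m + t * k) mod int p - (x * m + t * k)) + (x - r e t) * m
        + (r e t * m + t * k - base (e * m) - t * (k - base m))" by (simp add: algebra_simps)
    show ?thesis unfolding eq by (rule dvd_add[OF dvd_add[OF 1 2] r_base[OF Q(1,2)]])
  qed
  show ?thesis
  proof (rule automorphic_if_orbits[of Q])
    show "(e = 1 \<or> e = - 1) \<and> \<not> int p dvd t" if "Q e x t" for e x t
      using that Ee by (auto simp: Q_def)
    show "Q 1 0 1" using E p1 by (auto simp: Q_def r_def)
    show "Q (e * e') (x * e' + t * x') (t * t')" if "Q e x t" "Q e' x' t'" for e x t e' x' t'
    proof -
      have Q: "e \<in> E" "\<not> int p dvd t" "int p dvd x - r e t" "e' \<in> E" "\<not> int p dvd t'" "int p dvd x' - r e' t'"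
        using that by (auto simp: Q_def)
      have "x * e' + t * x' - r (e * e') (t * t') = e' * (x - r e t) + t * (x' - r e' t')
          + (r e t * e' + t * r e' t' - r (e * e') (t * t'))" by (simp add: algebra_simps)
      moreover have "int p dvd \<dots>"
        using Q r_comp[OF Q(1,4,2), of t'] by (intro dvd_add) auto
      ultimately have "int p dvd x * e' + t * x' - r (e * e') (t * t')" by (simp only:)
      then show ?thesis using Q Emult p by (simp add: Q_def prime_dvd_mult_iff)
    qed
    show "Q e (- (e * t' * x)) t'" if "Q e x t" and t': "[t * t' = 1] (mod int p)" for e x t t'
    proof -
      have Q: "e \<in> E" "\<not> int p dvd t" "int p dvd x - r e t" using that by (auto simp: Q_def)
      have d: "int p dvd t * t' - 1" using t' by (simp add: cong_iff_dvd_diff)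
      have nt': "\<not> int p dvd t'"
      proof
        assume "int p dvd t'"
        then have "int p dvd t * t'" by simp
        then show False using cong_dvd_iff[OF t'] p1 by simp
      qed
      have "- (e * t' * x) - r e t' = - (e * t') * (x - r e t) + (- (e * t' * r e t) - r e t')"
        by (simp add: algebra_simps)
      moreover have "int p dvd \<dots>"
        using r_inv[OF Q(1) nt' d] Q(3) by (intro dvd_add) auto
      ultimately have "int p dvd - (e * t' * x) - r e t'" by (simp only:)
      then show ?thesis using Q nt' by (simp add: Q_def)
    qed
    fix g h assume g: "g \<in> Gc p" and h: "h \<in> Gc p"
    show "same g h \<longleftrightarrow> (\<exists>e x t. Q e x t \<and> au p e x t g = h)"
      unfolding same[OF g h]
    proof
      assume a: "(\<exists>e\<in>E. fst h = e * fst g) \<and>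
        (int p dvd snd g - base (fst g) \<longleftrightarrow> int p dvd snd h - base (fst h))"
      then obtain e where e: "e \<in> E" "fst h = e * fst g" by blast
      obtain t where t: "\<not> int p dvd t" "int p dvd (snd h - base (fst h)) - t * (snd g - base (fst g))"
        using a exists_unit_multiplier by blast
      have Q: "Q e (r e t) t" using e t by (simp add: Q_def)
      have "int p dvd (snd h - base (fst h) - t * (snd g - base (fst g))) -
         ((r e t * fst g + t * snd g) mod int p - base (e * fst g) - t * (snd g - base (fst g)))"
        by (rule dvd_diff[OF t(2) action[OF Q]])
      then have "int p dvd snd h - (r e t * fst g + t * snd g) mod int p" by (simp add: e)
      then have "snd h mod int p = (r e t * fst g + t * snd g) mod int p"
        by (simp add: mod_eq_dvd_iff[symmetric])
      then have "snd h = (r e t * fst g + t * snd g) mod int p" using h by (auto simp: Gc_def)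
      then have "au p e (r e t) t g = h" using g e by (simp add: au_def prod_eq_iff)
      then show "\<exists>e x t. Q e x t \<and> au p e x t g = h" using Q by blast
    next
      assume "\<exists>e x t. Q e x t \<and> au p e x t g = h"
      then obtain e x t where Q: "Q e x t" and h': "au p e x t g = h" by blast
      have e: "e \<in> E" and t: "\<not> int p dvd t" using Q by (auto simp: Q_def)
      have fst: "fst h = e * fst g" and snd: "snd h = (x * fst g + t * snd g) mod int p"
        using g by (auto simp: au_def simp flip: h')
      have "int p dvd (snd h - base (fst h)) - t * (snd g - base (fst g))"
        using action[OF Q, of "fst g" "snd g"] by (simp only: fst snd)
      then have "int p dvd snd h - base (fst h) \<longleftrightarrow> int p dvd t * (snd g - base (fst g))"
        by (metis mod_eq_dvd_iff mod_eq_0_iff_dvd)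
      also have "\<dots> \<longleftrightarrow> int p dvd snd g - base (fst g)" using t p by (simp add: prime_dvd_mult_iff)
      finally show "(\<exists>e\<in>E. fst h = e * fst g) \<and>
        (int p dvd snd g - base (fst g) \<longleftrightarrow> int p dvd snd h - base (fst h))" using e fst by blast
    qed
  qed
qed

text \<open>The free parameter s moves a point through its whole layer m if p does not divide m, and
  has no effect if p does; there only the multipliers t act.\<close>

lemma automorphic_coset:
  assumes C1: "lay p {1} \<in> \<D>" and K: "Sset {(int p * m, 0) | m. True}"
  shows "automorphic p (span_cls \<D> :: (int \<times> int \<Rightarrow> 'f::field_char_0) set)"
proof (rule automorphic_if_orbits[of "\<lambda>e s t. e = 1 \<and> t \<in> mults"])
  show "1 = (1::int) \<and> 1 \<in> mults" using mults_1 by simp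
  show "(e = 1 \<or> e = - 1) \<and> \<not> int p dvd t" if "e = 1 \<and> t \<in> mults" for e t
    using that by (simp add: mults_def)
  show "e * e' = 1 \<and> t * t' \<in> mults" if "e = 1 \<and> t \<in> mults" "e' = 1 \<and> t' \<in> mults" for e t e' t' :: int
    using that mults_mult by simp
  show "e = 1 \<and> t' \<in> mults" if "e = 1 \<and> t \<in> mults" "[t * t' = 1] (mod int p)" for e t t' :: int
    using that mults_inverse by blast
  fix g h assume g: "g \<in> Gc p" and h: "h \<in> Gc p"
  show "same g h \<longleftrightarrow> (\<exists>e s t. (e = 1 \<and> t \<in> mults) \<and> au p e s t g = h)"
    unfolding same_coset_layer[OF C1 K g h]
  proof
    assume gh: "fst g = fst h \<and> (int p dvd fst g \<longrightarrow> (\<exists>t\<in>mults. snd h = t * snd g mod int p))"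
    show "\<exists>e s t. (e = 1 \<and> t \<in> mults) \<and> au p e s t g = h"
    proof (cases "int p dvd fst g")
      case True
      then obtain t where "t \<in> mults" "snd h = t * snd g mod int p" using gh by blast
      then have "(1 = (1::int) \<and> t \<in> mults) \<and> au p 1 0 t g = h"
        using g gh by (simp add: au_def prod_eq_iff)
      then show ?thesis by blast
    next
      case False
      then obtain x where x: "[fst g * x = 1] (mod int p)"
        using coprime_int_p cong_solve_coprime_int by blast
      have "[fst g * x * (snd h - snd g) = 1 * (snd h - snd g)] (mod int p)"
        by (rule cong_scalar_right[OF x])
      then have "[fst g * x * (snd h - snd g) + snd g = 1 * (snd h - snd g) + snd g] (mod int p)"
        by (rule cong_add[OF _ cong_refl])
      then have "((x * (snd h - snd g)) * fst g + 1 * snd g) mod int p = snd h mod int p"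
        by (simp add: cong_def algebra_simps)
      also have "\<dots> = snd h" using h by (auto simp: Gc_def)
      finally have "au p 1 (x * (snd h - snd g)) 1 g = h"
        using g gh by (simp add: au_def prod_eq_iff)
      then show ?thesis using mults_1 by blast
    qed
  next
    assume "\<exists>e s t. (e = 1 \<and> t \<in> mults) \<and> au p e s t g = h"
    then obtain s t where t: "t \<in> mults" "au p 1 s t g = h" by blast
    then have "fst h = fst g" "snd h = (s * fst g + t * snd g) mod int p"
      using g by (auto simp: au_def)
    moreover from this have "snd h = t * snd g mod int p" if "int p dvd fst g"
      using that by (metis add.commute dvd_mult mod_add_self2 dvd_imp_mod_0 mod_add_right_eq add_0_right)
    ultimately show "fst g = fst h \<and> (int p dvd fst g \<longrightarrow> (\<exists>t\<in>mults. snd h = t * snd g mod int p))"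
      using t(1) by auto
  qed
qed


section \<open>The cases of the theorem\<close>

text \<open>By \<open>one_layer_core\<close> one of the two classes is a singleton: C1 if
  \<open>card B = 1\<close>, and C2 if \<open>card B = p - 1\<close>.\<close>

lemma automorphic_one_layer:
  assumes C: "C1 \<in> \<D>" "C2 \<in> \<D>" "C1 \<noteq> C2" "C1 \<union> C2 = lay p {1}"
    and K: "Sset {(int p * m, 0) | m. True}"
  shows "automorphic p (span_cls \<D> :: (int \<times> int \<Rightarrow> 'f::field_char_0) set)"
proof -
  have L: "Sset (lay p {j})" for j
    using Sset_lay_all Sset_Un[OF Sset_class[OF C(1)] Sset_class[OF C(2)]] C(4) by simp
  define B where "B = {k. (1, k) \<in> C1}"
  have "C1 \<inter> C2 = {}" using C(1-3) disj by blast
  then have C2_eq: "C2 = lay p {1} - C1" using C(4) by blast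
  have sub1: "C1 \<subseteq> lay p {1}" using C(4) by blast
  have C1': "C1 = {1} \<times> B" using sub1 by (auto simp: B_def lay_def)
  have C2': "C2 = {1} \<times> ({0..<int p} - B)" unfolding C2_eq by (auto simp: B_def lay_def)
  have B: "B \<subseteq> {0..<int p}" using sub1 by (auto simp: B_def lay_def)
  note core = one_layer_core[OF C(1)[unfolded C1'] C(2)[unfolded C2'] B K L]
  have "\<exists>s. {(1, s)} \<in> \<D>"
    using core(2)
  proof
    assume "card B = 1"
    then obtain s where "B = {s}" by (rule card_1_singletonE)
    then have "C1 = {(1, s)}" using C1' by simp
    then show ?thesis using C(1) by blast
  next
    assume "card B = p - 1"
    then have "card ({0..<int p} - B) = 1"
      using B p0 by (simp add: card_Diff_subset finite_subset[OF B])
    then obtain s where "{0..<int p} - B = {s}" by (rule card_1_singletonE)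
    then have "C2 = {(1, s)}" using C2' by simp
    then show ?thesis using C(2) by blast
  qed
  then obtain s where s: "{(1, s)} \<in> \<D>" by blast
  show ?thesis
  proof (rule automorphic_linear[of "{1}" s "- s"])
    fix g h assume "g \<in> Gc p" "h \<in> Gc p"
    from same_one_layer[OF L s core(1) this]
    show "same g h \<longleftrightarrow> (\<exists>e\<in>{1}. fst h = e * fst g) \<and>
        (int p dvd snd g - (if 0 \<le> fst g then s * fst g else - (- s) * fst g) \<longleftrightarrow>
         int p dvd snd h - (if 0 \<le> fst h then s * fst h else - (- s) * fst h))"
      by auto
  qed simp_all
qed

lemma automorphic_pair_class:
  assumes C: "{(1, s), (- 1, s')} \<in> \<D>" "C2 \<in> \<D>" "{(1, s), (- 1, s')} \<union> C2 = lay p {1, - 1}"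
    and c: "int p dvd s + s' \<or> p = 2" and triv: triv0 and L: "\<And>j. Sset (lay p {j, - j})"
  shows "automorphic p (span_cls \<D> :: (int \<times> int \<Rightarrow> 'f::field_char_0) set)"
proof (rule automorphic_linear[of "{1, - 1}" s s'])
  fix g h assume "g \<in> Gc p" "h \<in> Gc p"
  note same_two_layer[OF L triv C c this]
  moreover have "\<bar>fst g\<bar> = \<bar>fst h\<bar> \<longleftrightarrow> (\<exists>e\<in>{1, - 1}. fst h = e * fst g)" by auto
  ultimately show "same g h \<longleftrightarrow> (\<exists>e\<in>{1, - 1}. fst h = e * fst g) \<and>
        (int p dvd snd g - (if 0 \<le> fst g then s * fst g else - s' * fst g) \<longleftrightarrow>
         int p dvd snd h - (if 0 \<le> fst h then s * fst h else - s' * fst h))" by simp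
qed (use c in simp_all)

lemma neg_neg_mod: "k \<in> {0..<int p} \<Longrightarrow> (- ((- k) mod int p)) mod int p = k"
  by (simp add: mod_minus_eq)

lemma inj_on_neg_mod: "inj_on (\<lambda>k. (- k) mod int p) {0..<int p}"
  by (rule inj_on_inverseI[of _ "\<lambda>k. (- k) mod int p"]) (rule neg_neg_mod)

lemma image_neg_mod: "(\<lambda>k. (- k) mod int p) ` {0..<int p} = {0..<int p}"
proof (intro subset_antisym subsetI)
  fix k assume "k \<in> {0..<int p}"
  then show "k \<in> (\<lambda>k. (- k) mod int p) ` {0..<int p}"
    using p0 by (intro image_eqI[of _ _ "(- k) mod int p"]) (simp_all add: neg_neg_mod[symmetric])
qed (use p0 in auto)

lemma image_neg_mod_Diff:
  assumes "B \<subseteq> {0..<int p}"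
  shows "(\<lambda>k. (- k) mod int p) ` ({0..<int p} - B) = {0..<int p} - (\<lambda>k. (- k) mod int p) ` B"
  using inj_on_image_set_diff[OF inj_on_neg_mod _ assms, of "{0..<int p}"] by (simp add: image_neg_mod)

text \<open>Here w' is the inverse of w, so \<open>s + s'\<close> vanishes modulo p.\<close>

lemma automorphic_pair_class_symmetric:
  assumes C: "{1} \<times> B \<union> {- 1} \<times> ((\<lambda>k. (- k) mod int p) ` B) \<in> \<D>" "C2 \<in> \<D>"
      "{1} \<times> B \<union> {- 1} \<times> ((\<lambda>k. (- k) mod int p) ` B) \<union> C2 = lay p {1, - 1}"
    and B: "card B = 1" and triv: triv0 and L: "\<And>j. Sset (lay p {j, - j})"
  shows "automorphic p (span_cls \<D> :: (int \<times> int \<Rightarrow> 'f::field_char_0) set)"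
proof -
  obtain s where s: "B = {s}" using B by (rule card_1_singletonE)
  have eq: "{1} \<times> B \<union> {- 1} \<times> ((\<lambda>k. (- k) mod int p) ` B) = {(1, s), (- 1, (- s) mod int p)}"
    by (auto simp: s)
  have "(s + (- s) mod int p) mod int p = 0" by (simp add: mod_simps)
  then have "int p dvd s + (- s) mod int p" by (rule mod_0_imp_dvd)
  then show ?thesis
    using automorphic_pair_class[OF C(1)[unfolded eq] C(2) C(3)[unfolded eq] _ triv L] by blast
qed

text \<open>On two residues the coefficients are given by the value c at 1 and the increment n at
  0.\<close>

lemma triv0_2: "p = 2 \<Longrightarrow> triv0"
  unfolding triv0_def
proof (intro allI impI)
  fix U assume p2: "p = 2"
  have "cf p U i = (if int p dvd i then cf p U 0 - cf p U 1 else 0) + cf p U 1" for i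
  proof (cases "int p dvd i")
    case True
    then show ?thesis using cf_index_cong[of p i 0 U] by simp
  next
    case False
    then have "int p dvd i - 1" using p2 by simp
    then show ?thesis using False cf_index_cong[of p i 1 U] by simp
  qed
  then show "\<exists>n c. \<forall>i. cf p U i = (if int p dvd i then n else 0) + c" by blast
qed

text \<open>Modulo p the p-th power of the class sum is the sum of the g^p, and g^p = z^(pi) for
  every g in the layer i because a^p = 1.\<close>

lemma power_class_count:
  assumes C: "C \<in> \<D>" and i: "i \<noteq> 0"
  shows "int p dvd gf p (bar C ^ p) (int p * i, 0) - int (card {g \<in> C. fst g = i})"
proof -
  have "of_nat p dvd bar C ^ p - (\<Sum>g\<in>C. mn g ^ p)"
    unfolding bar_def by (rule of_nat_prime_dvd_freshman_sum[OF p fin[OF C]])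
  then obtain V where V: "bar C ^ p - (\<Sum>g\<in>C. mn g ^ p) = of_nat p * V" by (rule dvdE)
  have "gf p (\<Sum>g\<in>C. mn g ^ p) (int p * i, 0) = (\<Sum>g\<in>C. if fst g = i then 1 else 0)"
    unfolding gf_sum mn_power gf_mn using p0 by (intro sum.cong refl) auto
  also have "\<dots> = int (card {g \<in> C. fst g = i})"
    using fin[OF C] by (simp add: sum.If_cases Int_def)
  finally have "gf p (bar C ^ p) (int p * i, 0) - int (card {g \<in> C. fst g = i})
      = gf p (of_nat p * V) (int p * i, 0)" unfolding V[symmetric] gf_diff by simp
  then show ?thesis by (simp add: gf_of_nat_mult)
qed

text \<open>Multiplication by z^p moves the layers of z and its inverse to those of z^(p+1) and z^(p-1), which are
  no longer inverse to each other.\<close>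

lemma Sset_lay_1_if_not_same:
  assumes L: "\<And>j. Sset (lay p {j, - j})" and K: "Sset {(int p * m, 0) | m. True}"
    and ns: "\<not> same (int p, 0) (- int p, 0)"
  shows "Sset (lay p {1})"
proof -
  have "(int p, 0) \<in> Gc p" using p0 by (simp add: Gc_def)
  then obtain C where C: "C \<in> \<D>" "(int p, 0) \<in> C" by (rule class_of)
  have "C \<subseteq> lay p {int p, - int p} \<inter> {(int p * m, 0) | m. True}"
  proof
    fix x assume x: "x \<in> C"
    have "(int p, 0) \<in> lay p {int p, - int p}" using p0 by (simp add: lay_def)
    moreover have "(int p, 0) \<in> {(int p * m, 0) | m. True}" by (auto intro: exI[of _ 1])
    ultimately show "x \<in> lay p {int p, - int p} \<inter> {(int p * m, 0) | m. True}"
      using SsetD[OF L C _ x] SsetD[OF K C _ x] by blast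
  qed
  moreover have "(- int p, 0) \<notin> C" using ns C unfolding same_def by blast
  ultimately have "C = {(int p, 0)}" using C(2) by (auto simp: lay_def)
  then have zp: "Sset {(int p, 0)}" using Sset_class[OF C(1)] by simp
  have zp': "Sset {(- int p, 0)}" using Sset_ginv[OF zp] by (simp add: ginv_def)
  have "Sel (mon 1 A + mon (- 1) A)" using Sel_fold_A[OF L, of 1] by simp
  from Sel_mult[OF this Sel_single_class[OF zp]]
  have f: "Sel (mon (1 + int p) A + mon (int p - 1) A)" by (simp add: distrib_right mult_single)
  have "Sel (mon (int p - 1) A)"
    by (rule Sel_lay[OF f L[of "int p - 1"]]) (use p1 in \<open>auto simp: lookup_add lookup_single when_def\<close>)
  from Sel_mult[OF this Sel_single_class[OF zp']] have "Sel (mon (- 1) A)" by (simp add: mult_single)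
  then have "Sset (lay p {- 1})" by (rule Sset_lay_mon) (use p0 in \<open>simp add: cf_sm_full\<close>)
  then show ?thesis using Sset_lay_uminus[of "- 1"] by simp
qed

text \<open>Inversion maps C1 to C1 or to C2. In the first case the part B of C1 in the layer 1 is
  subject to \<open>two_layer_core\<close>. In the second the part E in the layer -1 has
  \<open>p - card B\<close> elements; then a full layer is a class or p = 2, since otherwise the
  layers come apart although C1 meets both.\<close>

lemma automorphic_two_layers:
  assumes C: "C1 \<in> \<D>" "C2 \<in> \<D>" "C1 \<noteq> C2" "C1 \<union> C2 = lay p {1, - 1}"
    and K: "Sset {(int p * m, 0) | m. True}"
  shows "automorphic p (span_cls \<D> :: (int \<times> int \<Rightarrow> 'f::field_char_0) set)"
proof -
  define R where "R = {0..<int p}"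
  define neg where "neg = (\<lambda>k. (- k) mod int p)"
  define B where "B = {k. (1, k) \<in> C1}"
  define E where "E = {k. (- 1, k) \<in> C1}"
  have L: "Sset (lay p {j, - j})" for j
    using Sset_fold_all Sset_Un[OF Sset_class[OF C(1)] Sset_class[OF C(2)]] C(4) by simp
  have "C1 \<inter> C2 = {}" using C(1-3) disj by blast
  then have C2_eq: "C2 = lay p {1, - 1} - C1" using C(4) by blast
  have sub1: "C1 \<subseteq> lay p {1, - 1}" using C(4) by blast
  have C1: "C1 = {1} \<times> B \<union> {- 1} \<times> E" using sub1 by (auto simp: B_def E_def lay_def)
  have C2: "C2 = {1} \<times> (R - B) \<union> {- 1} \<times> (R - E)"
    unfolding C2_eq by (auto simp: B_def E_def R_def lay_def)
  have B: "B \<subseteq> R" and E: "E \<subseteq> R" using sub1 by (auto simp: B_def E_def R_def lay_def)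
  have finB: "finite B" and finE: "finite E" using B E finite_subset unfolding R_def by blast+
  have cardR: "card R = p" by (simp add: R_def)
  have negR: "neg ` (R - X) = R - neg ` X" if "X \<subseteq> R" for X
    using image_neg_mod_Diff that unfolding neg_def R_def .
  have card_neg: "card (neg ` X) = card X" if "X \<subseteq> R" for X
    unfolding neg_def by (rule card_image[OF inj_on_subset[OF inj_on_neg_mod that[unfolded R_def]]])
  have inv_C1: "ginv p ` C1 = {1} \<times> (neg ` E) \<union> {- 1} \<times> (neg ` B)"
    unfolding C1 image_Un ginv_times neg_def by auto
  have times_eq: "X = X' \<and> Y = Y'"
    if eq: "{1 :: int} \<times> X \<union> {- 1} \<times> Y = {1} \<times> X' \<union> {- 1} \<times> Y'" for X Y X' Y' :: "int set"
  proof -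
    have "(j, k) \<in> {1} \<times> X \<union> {- 1} \<times> Y \<longleftrightarrow> (j, k) \<in> {1} \<times> X' \<union> {- 1} \<times> Y'" for j k :: int
      by (simp only: eq)
    from this[of 1] this[of "- 1"] show ?thesis by auto
  qed
  obtain x where x: "x \<in> ginv p ` C1" using ne[OF C(1)] by blast
  have "neg ` X \<subseteq> R" for X using p0 by (auto simp: neg_def R_def)
  then have "ginv p ` C1 \<subseteq> lay p {1, - 1}" unfolding inv_C1 by (fastforce simp: lay_def R_def)
  then have "x \<in> C1 \<or> x \<in> C2" using x C(4) by blast
  then have "ginv p ` C1 = C1 \<or> ginv p ` C1 = C2"
    using disj[OF inv[OF C(1)] C(1) x] disj[OF inv[OF C(1)] C(2) x] by blast
  then show ?thesis
  proof
    assume sym: "ginv p ` C1 = C1"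
    have EB: "E = neg ` B"
      using times_eq[OF trans[OF inv_C1[symmetric] trans[OF sym C1]]] by blast
    have "B \<noteq> {}" using ne[OF C(1)] C1 EB by auto
    moreover have "B \<noteq> R"
    proof
      assume "B = R"
      then have "R - E = {}" using negR[of "{}"] EB by simp
      then show False using ne[OF C(2)] C2 \<open>B = R\<close> by simp
    qed
    moreover have C1': "C1 = {1} \<times> B \<union> {- 1} \<times> ((\<lambda>k. (- k) mod int p) ` B)"
      using C1 EB by (simp add: neg_def)
    moreover have C2': "C2 = {1} \<times> (R - B) \<union> {- 1} \<times> ((\<lambda>k. (- k) mod int p) ` (R - B))"
      using C2 EB negR[OF B] by (simp add: neg_def)
    ultimately have core: "triv0" "card B = 1 \<or> card B = p - 1"
      using two_layer_core[of B C2, OF _ C(2) _ _ _ _ K L] C(1) B by (auto simp: R_def)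
    from core(2) show ?thesis
    proof
      assume "card B = 1"
      then show ?thesis
        using automorphic_pair_class_symmetric[of B C2] C(1,2,4) C1' core(1) L by simp
    next
      assume "card B = p - 1"
      then have "card (R - B) = 1" using B finB cardR p0 by (simp add: card_Diff_subset)
      then show ?thesis
        using automorphic_pair_class_symmetric[of "R - B" C1] C(1,2,4) C2' core(1) L by (simp add: Un_commute)
    qed
  next
    assume sym: "ginv p ` C1 = C2"
    have EB: "neg ` E = R - B" "neg ` B = R - E"
      using times_eq[OF trans[OF inv_C1[symmetric] trans[OF sym C2]]] by blast+
    have card_BE: "card E = p - card B"
      using card_neg[OF E] EB(1) B finB cardR by (simp add: card_Diff_subset)
    consider "B = {}" | "B = R" | "B \<noteq> {}" "B \<noteq> R" by blast
    then show ?thesis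
    proof cases
      case 1
      then have "C2 = lay p {1}" using EB E C2 by (auto simp: lay_def R_def)
      then show ?thesis using automorphic_coset[OF _ K] C(2) by simp
    next
      case 2
      then have "C1 = lay p {1}" using EB C1 by (auto simp: lay_def R_def)
      then show ?thesis using automorphic_coset[OF _ K] C(1) by simp
    next
      case 3
      have "card B < card R" using B 3 by (intro psubset_card_mono) (auto simp: R_def)
      then have B_less: "card B < p" by (simp add: cardR)
      have B_pos: "0 < card B" using 3 finB by (simp add: card_gt_0_iff)
      show ?thesis
      proof (cases "p = 2")
        case True
        then have "card B = 1" "card E = 1" using B_less B_pos card_BE by auto
        then obtain s s' where "B = {s}" "E = {s'}" by (metis card_1_singletonE)
        \<comment> \<open>The exceptional pair: linked by a class, although inversion exchanges this
          class with the other one.\<close>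
        then have "C1 = {(1, s), (- 1, s')}" using C1 by auto
        then show ?thesis
          using automorphic_pair_class[of s s' C2] C(1,2,4) True triv0_2 L by simp
      next
        case False
        have "\<not> same (int p, 0) (- int p, 0)"
        proof
          assume "same (int p, 0) (- int p, 0)"
          \<comment> \<open>Equal coefficients at z^p and z^-p make \<open>card B\<close> and
            \<open>card E\<close> congruent modulo p.\<close>
          then have eq: "gf p (bar C1 ^ p) (int p, 0) = gf p (bar C1 ^ p) (- int p, 0)"
            by (rule same_Sel[OF _ Sel_power[OF Sel_bar_class[OF C(1)]]])
          have "{g \<in> C1. fst g = 1} = {1} \<times> B" "{g \<in> C1. fst g = - 1} = {- 1} \<times> E"
            unfolding C1 by auto
          then have d: "int p dvd gf p (bar C1 ^ p) (int p, 0) - int (card B)"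
              "int p dvd gf p (bar C1 ^ p) (- int p, 0) - int (card E)"
            using power_class_count[OF C(1), of 1] power_class_count[OF C(1), of "- 1"]
            by (simp_all add: card_cartesian_product_singleton)
          have "int p dvd int (card B) - int (card E)"
            using dvd_diff[OF d(2,1)] by (simp add: eq)
          \<comment> \<open>As \<open>p - card E\<close> is \<open>card B\<close>, the sum is
            \<open>2 * card B\<close>.\<close>
          then have "int p dvd int (card B) - int (card E) + int p" by simp
          then have "int p dvd 2 * int (card B)" using card_BE B_less by (simp add: of_nat_diff)
          then have "p dvd 2 * card B" by (metis int_dvd_int_iff of_nat_mult of_nat_numeral)
          then have "p dvd 2 \<or> p dvd card B" using p by (simp add: prime_dvd_mult_iff)
          then show False
            using False B_less B_pos p1 by (auto dest: dvd_imp_le)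
        qed
        then have lay1: "Sset (lay p {1})" by (rule Sset_lay_1_if_not_same[OF L K])
        obtain b where "b \<in> B" using 3 by blast
        then have b: "(1, b) \<in> C1" "(1, b) \<in> lay p {1}" using B by (auto simp: C1 lay_def R_def)
        \<comment> \<open>C1 meets the layer 1 and so lies in it; but an empty E would make B the
          full residue set.\<close>
        have "E = {}"
        proof (rule ccontr)
          assume "E \<noteq> {}"
          then obtain e where "(- 1, e) \<in> C1" using C1 by auto
          then have "(- 1, e) \<in> lay p {1}" by (rule SsetD[OF lay1 C(1) b])
          then show False by (simp add: lay_def)
        qed
        then show ?thesis using EB(1) B 3 by auto
      qed
    qed
  qed
qed

end

section \<open>From the Schur ring over the field to its partition\<close>

text \<open>Products of class sums have counts as coefficients. These are constant on classes as
  elements of the field, hence as numbers, because the characteristic is 0.\<close>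

lemma schur_partition_if_schur_ring:
  assumes "prime p" and S: "schur_ring p \<D> (S :: (int \<times> int \<Rightarrow> 'f::field_char_0) set)"
  shows "schur_partition p \<D>"
proof
  show "prime p" by fact
  fix C assume C: "C \<in> \<D>"
  show "C \<noteq> {}" "finite C" "C \<subseteq> Gc p" "ginv p ` C \<in> \<D>" using S C by (auto simp: schur_ring_def)
  fix C' assume C': "C' \<in> \<D>"
  show disj: "C = C'" if "x \<in> C" "x \<in> C'" for x using S C C' that unfolding schur_ring_def by blast
next
  show "\<Union>\<D> = Gc p" "{gone} \<in> \<D>" using S by (auto simp: schur_ring_def)
next
  fix C C' E x y assume C: "C \<in> \<D>" "C' \<in> \<D>" and E: "E \<in> \<D>" "x \<in> E" "y \<in> E"
  have "(cls_prod p C C' :: int \<times> int \<Rightarrow> 'f) \<in> span_cls \<D>"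
    using S C by (auto simp: schur_ring_def)
  then obtain T c where T: "T \<subseteq> \<D>" "(cls_prod p C C' :: int \<times> int \<Rightarrow> 'f) = (\<lambda>x. \<Sum>D\<in>T. c D * cls_sum D x)"
    unfolding span_cls_def by blast
  have "x \<in> D \<longleftrightarrow> y \<in> D" if "D \<in> T" for D
    using S E T(1) that unfolding schur_ring_def by (metis IntI empty_iff subsetD)
  then have "(cls_prod p C C' x :: 'f) = cls_prod p C C' y"
    unfolding T(2) by (intro sum.cong refl) (simp add: cls_sum_def)
  then show "card {(c, d). c \<in> C \<and> d \<in> C' \<and> gmul p c d = x} = card {(c, d). c \<in> C \<and> d \<in> C' \<and> gmul p c d = y}"
    by (simp add: cls_prod_def)
qed

theorem theorem3p10:
  fixes p :: nat and \<D> :: "(int \<times> int) set set"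
    and S :: "((int \<times> int) \<Rightarrow> 'f::field_char_0) set"
  assumes "prime p"
    and "schur_ring p \<D> S"
    and "S_subgroup \<D> {(int p * m, 0) | m. True}"
    and "(\<exists>C1\<in>\<D>. \<exists>C2\<in>\<D>. C1 \<noteq> C2 \<and> C1 \<union> C2 = {(1, k) | k. 0 \<le> k \<and> k < int p})
       \<or> (\<exists>C1\<in>\<D>. \<exists>C2\<in>\<D>. C1 \<noteq> C2 \<and>
            C1 \<union> C2 = {(1, k) | k. 0 \<le> k \<and> k < int p} \<union> {(-1, k) | k. 0 \<le> k \<and> k < int p})"
  shows "automorphic p S"
proof -
  interpret schur_partition p \<D> by (rule schur_partition_if_schur_ring[OF assms(1,2)])
  have S: "S = span_cls \<D>" using assms(2) by (simp add: schur_ring_def)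
  have K: "Sset {(int p * m, 0) | m. True}"
    using assms(3) p0 by (auto simp: Sset_def S_subgroup_def Gc_def)
  have lay: "{(1, k) | k. 0 \<le> k \<and> k < int p} = lay p {1}"
    "{(-1, k) | k. 0 \<le> k \<and> k < int p} = lay p {- 1}" "lay p {1} \<union> lay p {- 1} = lay p {1, - 1}"
    by (auto simp: lay_def)
  show ?thesis
    using assms(4) unfolding lay S
  proof (elim disjE bexE conjE)
    fix C1 C2 assume "C1 \<in> \<D>" "C2 \<in> \<D>" "C1 \<noteq> C2" "C1 \<union> C2 = lay p {1}"
    then show "automorphic p (span_cls \<D> :: (int \<times> int \<Rightarrow> 'f) set)"
      by (rule automorphic_one_layer[OF _ _ _ _ K])
  next
    fix C1 C2 assume "C1 \<in> \<D>" "C2 \<in> \<D>" "C1 \<noteq> C2" "C1 \<union> C2 = lay p {1, - 1}"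
    then show "automorphic p (span_cls \<D> :: (int \<times> int \<Rightarrow> 'f) set)"
      by (rule automorphic_two_layers[OF _ _ _ _ K])
  qed
qed

end
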